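(* Let $d\ge 1$ be an integer and $n=\lfloor d/2\rfloor$. For every sign sequence $s=(s_0,\dots,s_d)$ for $d$, the sequence $z(s)=(z_0(s),\dots,z_n(s))$ is an involutor (i.e. it satisfies the system $\mathfrak S(d)$). Moreover, every involutor arises in this way from a unique sign sequence: for every $z=(z_0,\dots,z_n)\in\mathbb C^{n+1}$ satisfying $\mathfrak S(d)$ there is exactly one sign sequence $s$ for $d$ such that $z=z(s)$.
   Context: Fix an integer $d\ge 1$ and let $n=\lfloor d/2\rfloor$. **Sign sequences.** A sign sequence for $d$ is a sequence $s=(s_0,\dots,s_d)$ with each $s_i\in\{1,-1\}$ and $s_{d-i}=(-1)^d s_i$ for all $i$ (for even $d$ the entry $s_{d/2}$ is arbitrary), so there are $2^{n+1}$ of them. **The sequence $z(s)$.** For $0\le \ell\le n$ let $m_\ell=\frac12$ if $d=2\ell$, and $m_\ell=1$ otherwise. For $0\le i\le n$ put $$z_i(s)=E_{1,i}\,E_{2,i},\qquad E_{1,i}=\frac{d!\,(2d-4i+1)!}{2^{2i-1}\,(d-2i)!^2},$$ $$E_{2,i}=\sum s_\ell\, m_\ell\,(-1)^q\,\frac{(d-2e)!\,(d-i-e)!}{(2d-2i-2e+1)!\,(i-e)!\,p!\,q!\,(\ell-p)!\,(d-\ell-q)!},$$ where the sum is over all integer quadruples $(e,\ell,p,q)$ with $0\le e\le i$, $0\le \ell\le n$, $0\le p\le \ell$, $0\le q\le d-\ell$, $p+q=d-2e$. **The numbers $\omega$.** Let $a,b,r,s$ be nonnegative integers with $r\le\min\{d,2b\}$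 and $s\le\min\{2a,2b+d-2r\}$, and let $t$ be an integer with $\max\{|a+b-r-s|,|a-b|\}\le t\le \min\{a+b+d-r-s,a+b\}$ and $t\equiv a+b \pmod 2$. Define $$\omega(a,b;r,s;t)=(-1)^{d+r+s+\frac12(a+b-t)}P_1P_2P_3,$$ $$P_1=\frac{a!\,b!\,r!\,s!\,(d-r)!\,(2b-r)!\,(2a-s)!\,(2b+d-2r-s)!}{(2a)!\,(2b)!\,(2b+d-2r)!},$$ $$P_2=\frac{(2t+1)!\,(\frac{a+b+t}{2})!\,(a+b-t)!\,(a-b+t)!\,(b-a+t)!}{t!\,(a+b+t+1)!\,(a+b+d-r-s+t+1)!\,(\frac{a+b-t}{2})!\,(\frac{a-b+t}{2})!\,(\frac{b-a+t}{2})!},$$ $$P_3=\sum_z (-1)^z(z+1)!\,\big\{(z-a-b-t)!\,(z-2b-d+r)!\,(z-2a-2b-d+2r+s)!\,(z-a-b-d+r+s-t)!\,(a+b+d-r+t-z)!\,(2a+2b+d-r-s-z)!\,(a+3b+d-2r-s+t-z)!\big\}^{-1},$$ the last sum being over all integers $z$ for which all factorials in the denominator have nonnegative arguments. **The system $\mathfrak S(d)$.** For $0\le i,j\le n$ and even $t$ with $2|i-j|\le t\le\min\{d,2(d-i-j)\}$ put $\alpha^{(t)}_{i,j}=\omega(d-2j,d-2i;d-2i,d-2j;t)$; for all other $t$ put $\alpha^{(t)}_{i,j}=0$. The system $\mathfrak S(d)$ in the unknowns $z=(z_0,\dots,z_n)\in\mathbb C^{n+1}$ consists of $$\sum_{0\le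 i,j\le n}\alpha^{(t)}_{i,j}z_iz_j=0\quad(t=2,4,\dots,2n),\qquad \sum_{i=0}^n\alpha^{(0)}_{i,i}z_i^2=1.$$ A sequence $z=(z_0,\dots,z_n)$ of complex numbers is called an involutor (for $d$) if it satisfies $\mathfrak S(d)$. *)

theory Defs
  imports Complex_Main "HOL-Library.FuncSet"
begin

text \<open>Finite sequences \<open>(x\<^sub>0,\<dots>,x\<^sub>N)\<close> are functions on \<open>nat\<close> that are extensional on
  \<open>{..N}\<close>, so that equality of functions is equality of sequences.\<close>

definition sign_sequences :: "nat \<Rightarrow> (nat \<Rightarrow> int) set" where
  "sign_sequences d =
     {s \<in> {..d} \<rightarrow>\<^sub>E {1, -1}. \<forall>i\<le>d. s (d - i) = (-1) ^ d * s i}"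

definition m_weight :: "nat \<Rightarrow> nat \<Rightarrow> complex" where
  "m_weight d l = (if d = 2 * l then 1 / 2 else 1)"

text \<open>The subtractions on \<open>nat\<close> in the next three definitions are exact for \<open>i \<le> d div 2\<close>,
  the only indices that are used.\<close>

definition E1 :: "nat \<Rightarrow> nat \<Rightarrow> complex" where
  "E1 d i = fact d * fact (2 * d - 4 * i + 1) / (2 powi (2 * int i - 1) * fact (d - 2 * i) ^ 2)"

definition E2_indices :: "nat \<Rightarrow> nat \<Rightarrow> (nat \<times> nat \<times> nat \<times> nat) set" where
  "E2_indices d i =
     {(e, l, p, q). e \<le> i \<and> l \<le> d div 2 \<and> p \<le> l \<and> q \<le> d - l \<and> p + q = d - 2 * e}"

definition E2 :: "nat \<Rightarrow> (nat \<Rightarrow> int) \<Rightarrow> nat \<Rightarrow> complex" where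
  "E2 d s i =
     (\<Sum>(e, l, p, q)\<in>E2_indices d i.
        of_int (s l) * m_weight d l * (-1) ^ q *
        (fact (d - 2 * e) * fact (d - i - e) /
         (fact (2 * d - 2 * i - 2 * e + 1) * fact (i - e) * fact p * fact q *
          fact (l - p) * fact (d - l - q))))"

lemma finite_E2_indices: "finite (E2_indices d i)"
proof (rule finite_subset)
  show "E2_indices d i \<subseteq> {..i} \<times> {..d div 2} \<times> {..d} \<times> {..d}"
    by (auto simp: E2_indices_def)
qed simp

definition zseq :: "nat \<Rightarrow> (nat \<Rightarrow> int) \<Rightarrow> nat \<Rightarrow> complex" where
  "zseq d s = (\<lambda>i\<in>{..d div 2}. E1 d i * E2 d s i)"

abbreviation ifact :: "int \<Rightarrow> complex" where
  "ifact k \<equiv> fact (nat k)"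

text \<open>The parameters for which \<open>omega\<close> is meant. On them every factorial below has a nonnegative
  argument and every division by 2 is exact; elsewhere \<open>omega\<close> has no significance.\<close>

definition omega_admissible :: "int \<Rightarrow> int \<Rightarrow> int \<Rightarrow> int \<Rightarrow> int \<Rightarrow> int \<Rightarrow> bool" where
  "omega_admissible d a b r s t \<longleftrightarrow>
     0 \<le> a \<and> 0 \<le> b \<and> 0 \<le> r \<and> 0 \<le> s \<and>
     r \<le> min d (2 * b) \<and> s \<le> min (2 * a) (2 * b + d - 2 * r) \<and>
     max \<bar>a + b - r - s\<bar> \<bar>a - b\<bar> \<le> t \<and> t \<le> min (a + b + d - r - s) (a + b) \<and>
     t mod 2 = (a + b) mod 2"

definition omega_P1 :: "int \<Rightarrow> int \<Rightarrow> int \<Rightarrow> int \<Rightarrow> int \<Rightarrow> complex" where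
  "omega_P1 d a b r s =
     ifact a * ifact b * ifact r * ifact s * ifact (d - r) * ifact (2 * b - r) *
     ifact (2 * a - s) * ifact (2 * b + d - 2 * r - s) /
     (ifact (2 * a) * ifact (2 * b) * ifact (2 * b + d - 2 * r))"

definition omega_P2 :: "int \<Rightarrow> int \<Rightarrow> int \<Rightarrow> int \<Rightarrow> int \<Rightarrow> int \<Rightarrow> complex" where
  "omega_P2 d a b r s t =
     ifact (2 * t + 1) * ifact ((a + b + t) div 2) * ifact (a + b - t) *
     ifact (a - b + t) * ifact (b - a + t) /
     (ifact t * ifact (a + b + t + 1) * ifact (a + b + d - r - s + t + 1) *
      ifact ((a + b - t) div 2) * ifact ((a - b + t) div 2) * ifact ((b - a + t) div 2))"

definition omega_P3_indices :: "int \<Rightarrow> int \<Rightarrow> int \<Rightarrow> int \<Rightarrow> int \<Rightarrow> int \<Rightarrow> int set" where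
  "omega_P3_indices d a b r s t =
     {z. 0 \<le> z - a - b - t \<and> 0 \<le> z - 2 * b - d + r \<and>
         0 \<le> z - 2 * a - 2 * b - d + 2 * r + s \<and> 0 \<le> z - a - b - d + r + s - t \<and>
         0 \<le> a + b + d - r + t - z \<and> 0 \<le> 2 * a + 2 * b + d - r - s - z \<and>
         0 \<le> a + 3 * b + d - 2 * r - s + t - z}"

lemma finite_omega_P3_indices: "finite (omega_P3_indices d a b r s t)"
proof (rule finite_subset)
  show "omega_P3_indices d a b r s t \<subseteq> {a + b + t .. a + b + d - r + t}"
    by (auto simp: omega_P3_indices_def)
qed simp

definition omega_P3 :: "int \<Rightarrow> int \<Rightarrow> int \<Rightarrow> int \<Rightarrow> int \<Rightarrow> int \<Rightarrow> complex" where
  "omega_P3 d a b r s t =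
     (\<Sum>z\<in>omega_P3_indices d a b r s t.
        (-1) powi z * ifact (z + 1) *
        inverse (ifact (z - a - b - t) * ifact (z - 2 * b - d + r) *
                 ifact (z - 2 * a - 2 * b - d + 2 * r + s) *
                 ifact (z - a - b - d + r + s - t) * ifact (a + b + d - r + t - z) *
                 ifact (2 * a + 2 * b + d - r - s - z) *
                 ifact (a + 3 * b + d - 2 * r - s + t - z)))"

definition omega :: "int \<Rightarrow> int \<Rightarrow> int \<Rightarrow> int \<Rightarrow> int \<Rightarrow> int \<Rightarrow> complex" where
  "omega d a b r s t =
     (-1) powi (d + r + s + (a + b - t) div 2) *
     omega_P1 d a b r s * omega_P2 d a b r s t * omega_P3 d a b r s t"

definition alpha_range :: "nat \<Rightarrow> nat \<Rightarrow> nat \<Rightarrow> int \<Rightarrow> bool" where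
  "alpha_range d i j t \<longleftrightarrow>
     even t \<and> 2 * \<bar>int i - int j\<bar> \<le> t \<and> t \<le> min (int d) (2 * (int d - int i - int j))"

definition alpha :: "nat \<Rightarrow> int \<Rightarrow> nat \<Rightarrow> nat \<Rightarrow> complex" where
  "alpha d t i j =
     (if alpha_range d i j t
      then omega (int d) (int d - 2 * int j) (int d - 2 * int i)
                 (int d - 2 * int i) (int d - 2 * int j) t
      else 0)"

lemma alpha_range_imp_omega_admissible:
  assumes "i \<le> d div 2" "j \<le> d div 2" "alpha_range d i j t"
  shows "omega_admissible (int d) (int d - 2 * int j) (int d - 2 * int i)
           (int d - 2 * int i) (int d - 2 * int j) t"
proof -
  define D I J where "D = int d" and "I = int i" and "J = int j"
  have ij: "0 \<le> I" "0 \<le> J" "2 * I \<le> D" "2 * J \<le> D"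
    using assms(1,2) by (auto simp: D_def I_def J_def)
  have t: "2 * (I - J) \<le> t" "2 * (J - I) \<le> t" "t \<le> D" "t \<le> 2 * (D - I - J)" and "even t"
    using assms(3) by (auto simp: alpha_range_def D_def I_def J_def abs_if split: if_splits)
  have "even (D - 2 * J + (D - 2 * I))" by simp
  with \<open>even t\<close> have "t mod 2 = (D - 2 * J + (D - 2 * I)) mod 2"
    by (simp only: even_iff_mod_2_eq_zero)
  then show ?thesis
    using ij t unfolding omega_admissible_def D_def[symmetric] I_def[symmetric] J_def[symmetric]
    by (simp add: abs_le_iff)
qed

definition involutors :: "nat \<Rightarrow> (nat \<Rightarrow> complex) set" where
  "involutors d =
     {z \<in> {..d div 2} \<rightarrow>\<^sub>E UNIV.
        (\<forall>t\<in>{2..2 * int (d div 2)}. even t \<longrightarrow>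
           (\<Sum>i\<le>d div 2. \<Sum>j\<le>d div 2. alpha d t i j * z i * z j) = 0) \<and>
        (\<Sum>i\<le>d div 2. alpha d 0 i i * (z i)\<^sup>2) = 1}"

end

theory Submission
  imports Defs "HOL-Computational_Algebra.Polynomial" "Jordan_Normal_Form.Determinant"
begin

text \<open>Let $Q = xy$. On binary forms of degree $d$, the transvection $F \mapsto (Q^a, F)_a$ is diagonal in
the monomials $x^{d-l} y^l$, and the eigenvalue on the monomial with index $l$ is, up to
normalisation, the discrete Chebyshev polynomial of degree $a$ at the point $l$ of
$\{0, \dots, d\}$. Write \<open>\<lambda>\<^sub>a(l)\<close> for the normalised value (\<open>eigval\<close> below). A sequence $z$ describes
the operator with eigenvalues \<open>\<mu>(l) = \<Sum>\<^sub>i z\<^sub>i \<lambda>\<^bsub>d-2i\<^esub>(l)\<close>, and the system says that this operator is an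
involution, i.e. that \<open>\<mu>(l)\<^sup>2 = 1\<close> for every $l$. The arguments below are about the numbers
\<open>\<lambda>\<^sub>a(l)\<close> only; forms and transvectants motivate them and do not occur.

Three facts carry the proof.

\<^item> Product formula (\<open>eigval_product\<close>): \<open>\<lambda>\<^sub>a \<lambda>\<^sub>b = \<Sum>\<^sub>t \<omega>(a,b;b,a;t) \<lambda>\<^sub>t\<close> for $a$ and $b$ of the parity of $d$,
where $t$ runs over even numbers. Since \<open>\<lambda>\<^sub>0 = 1\<close> and the \<open>\<lambda>\<^sub>t\<close> are linearly independent, comparing
coefficients in \<open>\<mu>\<^sup>2 = 1\<close> gives exactly the equations of the system (\<open>involutors_iff\<close>).

\<^item> Orthogonality and completeness (\<open>dcheb_orthogonal\<close>, \<open>dcheb_expansion\<close>): the functions with index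
\<open>a \<le> d\<close> form an orthogonal basis of the functions on $\{0, \dots, d\}$. As \<open>\<lambda>\<^sub>a\<close> has the parity of $a$ under
\<open>l \<mapsto> d - l\<close>, the ones with \<open>a \<equiv> d\<close> modulo 2 span the functions with the symmetry of a sign sequence.
Hence $z$ and \<open>\<mu>\<close> determine each other, and involutors correspond to sign sequences.

\<^item> Inversion (\<open>zseq_eq\<close>): the numbers \<open>z\<^sub>i(s)\<close> are the coordinates of $s$ in this basis.

The first two facts follow from one evaluation (\<open>triple_sum\<close>): the sum over $l$ of a product of three
discrete Chebyshev polynomials is an explicit factor times a Racah sum (which is, up to triangle
coefficients, a Wigner 6j symbol with three entries $d/2$). Both sides satisfy the same recurrence. For the left side it is the
three-term recurrence of the polynomials; for the right side it is a contiguous relation that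
telescopes term by term (\<open>racah_term_telescopes\<close>).

The polynomials are introduced through the expansion that occurs in \<open>E\<^sub>2\<close>: the products
$(1+x)^l (1-x)^{d-l}$ are paired with Legendre polynomials. This makes the inversion immediate, and
the three-term recurrence becomes a comparison of coefficients.\<close>

section \<open>Reciprocal factorials of integers\<close>

text \<open>The reciprocal Gamma function at $k+1$: it vanishes at negative integers, so that sums
of products of such factors have their natural finite support and the rule \<open>rfact_pred\<close> has no exceptions.\<close>

definition rfact :: "int \<Rightarrow> complex" where
  "rfact k = (if k < 0 then 0 else 1 / ifact k)"

lemma rfact_neg: "k < 0 \<Longrightarrow> rfact k = 0"
  by (simp add: rfact_def)

lemma ifact_Suc: "0 \<le> k \<Longrightarrow> ifact (k + 1) = of_int (k + 1) * ifact k"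
  by (simp add: nat_add_distrib)

lemma rfact_pred: "rfact (k - 1) = of_int k * rfact k"
proof (cases "k \<ge> 1")
  case True
  then show ?thesis using ifact_Suc[of "k - 1"] by (simp add: rfact_def)
next
  case False
  then show ?thesis by (cases "k = 0") (auto simp: rfact_def)
qed

lemma rfact_unfold: "rfact k = of_int (k + 1) * rfact (k + 1)"
  using rfact_pred[of "k + 1"] by simp

section \<open>Coefficients of products of powers of $1+x$ and $1-x$\<close>

text \<open>As a function of $l$ with $l + m$ fixed, this is the Krawtchouk polynomial of degree \<open>N\<close>.\<close>

definition krawtchouk :: "nat \<Rightarrow> nat \<Rightarrow> nat \<Rightarrow> complex" where
  "krawtchouk l m N = coeff ([:1, 1:] ^ l * [:1, -1:] ^ m) N"

lemma krawtchouk_eq_sum: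
  "krawtchouk l m N = (\<Sum>p\<le>N. of_nat (l choose p) * ((-1) ^ (N - p) * of_nat (m choose (N - p))))"
proof -
  have "coeff ([:1, c:] ^ n) k = c ^ k * of_nat (n choose k)" for c :: complex and n k
  proof (cases "k \<le> n")
    case True
    then show ?thesis using coeff_linear_poly_power[of k n 1 c] by (simp add: ac_simps)
  next
    case False
    have "degree ([:1, c:] ^ n) \<le> n"
      using degree_power_le[of "[:1, c:]" n] by (simp split: if_splits)
    then show ?thesis using False by (simp add: coeff_eq_0)
  qed
  then show ?thesis by (simp add: krawtchouk_def coeff_mult)
qed

lemma krawtchouk_eq_0: "l + m < N \<Longrightarrow> krawtchouk l m N = 0"
  unfolding krawtchouk_eq_sum by (intro sum.neutral) auto

text \<open>Exchanging \<open>l\<close> and \<open>m\<close> amounts to replacing \<open>x\<close> by \<open>-x\<close> in the generating polynomial.\<close>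

lemma krawtchouk_swap: "krawtchouk m l N = (-1) ^ N * krawtchouk l m N"
proof -
  have power: "pcompose (p ^ n) q = pcompose p q ^ n" for p q :: "complex poly" and n
    by (induction n) (simp_all add: pcompose_mult one_pCons)
  have "krawtchouk l m N = coeff (pcompose ([:1, 1:] ^ m * [:1, -1:] ^ l) [:0, -1:]) N"
    by (simp add: krawtchouk_def pcompose_mult power pcompose_pCons mult.commute)
  also have "\<dots> = (-1) ^ N * krawtchouk m l N"
    by (simp only: coeff_pcompose_linear krawtchouk_def)
  finally show ?thesis by (simp add: mult.assoc[symmetric] power_mult_distrib[symmetric])
qed

lemma krawtchouk_pderiv:
  "pderiv ([:1, 1:] ^ l * [:1, -1:] ^ m :: complex poly)
    = smult (of_nat l) ([:1, 1:] ^ (l - 1) * [:1, -1:] ^ m) - smult (of_nat m) ([:1, 1:] ^ l * [:1, -1:] ^ (m - 1))"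
  by (simp add: pderiv_mult pderiv_power pderiv_pCons algebra_simps)

text \<open>Coefficients of the derivative of $(1+x)^l (1-x)^m$.\<close>

lemma krawtchouk_lower:
  "of_nat l * krawtchouk (l - 1) m N - of_nat m * krawtchouk l (m - 1) N = of_nat (Suc N) * krawtchouk l m (Suc N)"
  using arg_cong[OF krawtchouk_pderiv[of l m], of "\<lambda>p. coeff p N"]
  by (simp add: krawtchouk_def coeff_pderiv)

text \<open>The polynomial $p = (1+x)^l (1-x)^m$ satisfies
$(1 - x^2) p' = l (1-x) p - m (1+x) p$; the claim compares coefficients.\<close>

lemma krawtchouk_recurrence:
  "(of_nat l - of_nat m) * krawtchouk l m N
    = of_nat (Suc N) * krawtchouk l m (Suc N)
      + (if N = 0 then 0 else (of_nat (l + m) + 1 - of_nat N) * krawtchouk l m (N - 1))"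
proof -
  define p where "p = ([:1, 1:] ^ l * [:1, -1:] ^ m :: complex poly)"
  have l: "[:1, 1:] * smult (of_nat l) ([:1, 1:] ^ (l - 1)) = smult (of_nat l) ([:1, 1:] ^ l :: complex poly)"
    by (cases l) (simp, simp only: mult_smult_right diff_Suc_1 power_Suc)
  have m: "[:1, -1:] * smult (of_nat m) ([:1, -1:] ^ (m - 1)) = smult (of_nat m) ([:1, -1:] ^ m :: complex poly)"
    by (cases m) (simp, simp only: mult_smult_right diff_Suc_1 power_Suc)
  have "[:1, 1:] * [:1, -1:] * pderiv p
     = ([:1, 1:] * smult (of_nat l) ([:1, 1:] ^ (l - 1))) * [:1, -1:] ^ m * [:1, -1:]
      - [:1, 1:] ^ l * ([:1, -1:] * smult (of_nat m) ([:1, -1:] ^ (m - 1))) * [:1, 1:]"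
    unfolding p_def krawtchouk_pderiv
    by (simp only: right_diff_distrib mult_smult_left mult_smult_right ac_simps)
  also have "\<dots> = smult (of_nat l) (p * [:1, -1:]) - smult (of_nat m) (p * [:1, 1:])"
    unfolding l m by (simp only: p_def mult_smult_left mult_smult_right ac_simps)
  finally have ode: "[:1, 1:] * [:1, -1:] * pderiv p = smult (of_nat l) (p * [:1, -1:]) - smult (of_nat m) (p * [:1, 1:])" .
  have quad: "[:1, 1:] * [:1, -1:] = ([:1, 0, -1:] :: complex poly)" by simp
  have "coeff ([:1, 0, -1:] * pderiv p) N = coeff (smult (of_nat l) (p * [:1, -1:]) - smult (of_nat m) (p * [:1, 1:])) N"
    using ode by (simp only: quad)
  moreover have "coeff p k = krawtchouk l m k" for k by (simp add: p_def krawtchouk_def)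
  ultimately show ?thesis
    by (cases N; cases "N - 1") (simp_all add: coeff_pderiv mult.commute[of p] algebra_simps)
qed

text \<open>Twice the sum of the odd coefficients of $(1+x)^l (1-x)^m$ is the difference of its values
at $1$ and $-1$, and both values vanish.\<close>

lemma krawtchouk_odd_sum:
  assumes "1 \<le> l" "1 \<le> m"
  shows "(\<Sum>N | N < l + m \<and> even N. krawtchouk l m (Suc N)) = 0"
proof -
  define p where "p = ([:1, 1:] ^ l * [:1, -1:] ^ m :: complex poly)"
  have c: "coeff p k = krawtchouk l m k" for k by (simp add: p_def krawtchouk_def)
  have deg: "degree p \<le> l + m"
    by (rule degree_le) (simp add: c krawtchouk_eq_0)
  have "poly p x = (\<Sum>N\<le>l + m. krawtchouk l m N * x ^ N)" for x
    unfolding poly_altdef c[symmetric]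
    by (rule sum.mono_neutral_left) (use deg in \<open>auto simp: coeff_eq_0\<close>)
  from this[of 1] this[of "-1"]
  have "(\<Sum>N\<le>l + m. krawtchouk l m N) = 0" "(\<Sum>N\<le>l + m. krawtchouk l m N * (-1) ^ N) = 0"
    using assms by (auto simp: p_def power_0_left)
  then have "0 = (\<Sum>N\<le>l + m. krawtchouk l m N - krawtchouk l m N * (-1) ^ N)"
    by (simp add: sum_subtractf)
  also have "\<dots> = (\<Sum>N | N \<le> l + m \<and> odd N. krawtchouk l m N - krawtchouk l m N * (-1) ^ N)"
    by (rule sum.mono_neutral_right) auto
  also have "\<dots> = (\<Sum>N | N \<le> l + m \<and> odd N. 2 * krawtchouk l m N)"
    by (rule sum.cong) auto
  also have "\<dots> = 2 * (\<Sum>N | N \<le> l + m \<and> odd N. krawtchouk l m N)"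
    by (simp add: sum_distrib_left)
  also have "(\<Sum>N | N \<le> l + m \<and> odd N. krawtchouk l m N) = (\<Sum>N | N < l + m \<and> even N. krawtchouk l m (Suc N))"
    by (rule sum.reindex_bij_witness[of _ Suc "\<lambda>N. N - 1"]) (auto elim: oddE)
  finally show ?thesis by simp
qed

text \<open>The binomial theorem for $((1+x) + (1-x))^d$.\<close>

lemma krawtchouk_binomial_sum:
  "(\<Sum>l\<le>d. of_nat (d choose l) * krawtchouk l (d - l) N) = (if N = 0 then 2 ^ d else 0)"
proof -
  have "(\<Sum>l\<le>d. of_nat (d choose l) * ([:1, 1:] ^ l * [:1, -1:] ^ (d - l))) = ([:1, 1:] + [:1, -1:] :: complex poly) ^ d"
    by (simp only: binomial_ring mult.assoc)
  also have "[:1, 1:] + [:1, -1:] = ([:2:] :: complex poly)"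
    by simp
  also have "[:2:] ^ d = ([:2 ^ d:] :: complex poly)"
    by (rule poly_const_pow)
  finally have "coeff (\<Sum>l\<le>d. of_nat (d choose l) * ([:1, 1:] ^ l * [:1, -1:] ^ (d - l))) N = coeff [:2 ^ d :: complex:] N"
    by simp
  then show ?thesis
    by (simp add: coeff_sum krawtchouk_def of_nat_poly coeff_pCons split: nat.splits)
qed

section \<open>Legendre moments and discrete Chebyshev polynomials\<close>

text \<open>Up to the factor $2^a$ this is \<open>\<integral> x\<^sup>N P\<^sub>a(x) dx / 2\<close> over $[-1,1]$, with \<open>P\<^sub>a\<close> the Legendre
polynomial. The reciprocal factorial accounts for its vanishing when \<open>N < a\<close>.\<close>

definition legendre_moment :: "int \<Rightarrow> int \<Rightarrow> complex" where
  "legendre_moment a N = (if even (N + a)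
     then ifact N * ifact ((N + a) div 2) * rfact ((N - a) div 2) * rfact (N + a + 1) else 0)"

text \<open>The first relation is the three-term recurrence of the Legendre polynomials, integrated against
$x^N$; the second one evaluates the integral of $P_a(x)\,(1-x^2)\,(x^N)'$ by parts. All moments that occur are polynomial
multiples of a single product of factorials.\<close>

lemma legendre_moment_contiguous:
  assumes "0 \<le> a" "0 \<le> N"
  shows "4 * (of_int a + 1) * legendre_moment (a + 1) N + of_int a * legendre_moment (a - 1) N = 2 * (2 * of_int a + 1) * legendre_moment a (N + 1)"
    and "4 * (of_int a + 1) * (of_int a + 2) * legendre_moment (a + 1) N - of_int a * (of_int a - 1) * legendre_moment (a - 1) N
      = 2 * (2 * of_int a + 1) * of_int N * (legendre_moment a (N - 1) - legendre_moment a (N + 1))"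
proof -
  have "4 * (of_int a + 1) * legendre_moment (a + 1) N + of_int a * legendre_moment (a - 1) N = 2 * (2 * of_int a + 1) * legendre_moment a (N + 1) \<and>
      4 * (of_int a + 1) * (of_int a + 2) * legendre_moment (a + 1) N - of_int a * (of_int a - 1) * legendre_moment (a - 1) N
      = 2 * (2 * of_int a + 1) * of_int N * (legendre_moment a (N - 1) - legendre_moment a (N + 1))"
  proof (cases "even (N + a)")
    case True
    then have "odd (N + (a + 1))" "odd (N + (a - 1))" "odd (N + 1 + a)" "odd (N - 1 + a)" by presburger+
    then show ?thesis by (simp only: legendre_moment_def) simp
  next
    case False
    then obtain k where "N + a = 2 * k + 1" by (elim oddE)
    define v where "v = k + 1"
    have v: "N + a = 2 * v - 1" using \<open>N + a = 2 * k + 1\<close> by (simp add: v_def)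
    define u where "u = v - a"
    have N: "N = u + v - 1" and a: "a = v - u" using v by (auto simp: u_def)
    have "1 \<le> v" using v assms by linarith
    \<comment> \<open>The arguments are chosen so that every moment in the claim is a polynomial multiple of \<open>base\<close>.\<close>
    define base where "base = ifact N * ifact (v - 1) * rfact u * rfact (2 * v + 1)"
    have fv: "ifact v = of_int v * ifact (v - 1)"
      using ifact_Suc[of "v - 1"] \<open>1 \<le> v\<close> by simp
    have ru: "rfact (u - 1) = of_int u * rfact u" by (rule rfact_pred)
    have rv: "rfact (2 * v - 1) = of_int (2 * v) * (of_int (2 * v + 1) * rfact (2 * v + 1))"
      using rfact_pred[of "2 * v"] rfact_pred[of "2 * v + 1"] by simp
    have par: "even (N + (a + 1))" "even (N + (a - 1))" "even (N + 1 + a)" "even (N - 1 + a)"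
      using False by presburger+
    have idx: "(N + (a + 1)) div 2 = v" "(N - (a + 1)) div 2 = u - 1" "N + (a + 1) + 1 = 2 * v + 1"
      "(N + (a - 1)) div 2 = v - 1" "(N - (a - 1)) div 2 = u" "N + (a - 1) + 1 = 2 * v - 1"
      "(N + 1 + a) div 2 = v" "(N + 1 - a) div 2 = u" "N + 1 + a + 1 = 2 * v + 1"
      "(N - 1 + a) div 2 = v - 1" "(N - 1 - a) div 2 = u - 1" "N - 1 + a + 1 = 2 * v - 1"
      unfolding N a by auto
    have l1: "legendre_moment (a + 1) N = of_int (u * v) * base"
      using par unfolding legendre_moment_def idx fv ru base_def by simp
    have l2: "legendre_moment (a - 1) N = of_int (2 * v * (2 * v + 1)) * base"
      using par unfolding legendre_moment_def idx rv base_def by simp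
    have l3: "legendre_moment a (N + 1) = of_int ((N + 1) * v) * base"
      using par assms unfolding legendre_moment_def idx fv base_def by (simp add: ifact_Suc)
    have l4: "of_int N * legendre_moment a (N - 1) = of_int (u * (2 * v * (2 * v + 1))) * base"
    proof (cases "N = 0")
      case True
      \<comment> \<open>Here the moment with index $-1$ has no meaning, but \<open>base\<close> comes with the factor \<open>u * rfact u = 0\<close>.\<close>
      then have "u \<le> 0" using \<open>1 \<le> v\<close> N by simp
      then have "of_int u * rfact u = 0" by (cases "u = 0") (simp_all add: rfact_neg)
      then show ?thesis using True by (auto simp: base_def)
    next
      case False
      then have "ifact N = of_int N * ifact (N - 1)"
        using ifact_Suc[of "N - 1"] assms by simp
      then show ?thesis using par unfolding legendre_moment_def idx ru rv base_def by simp
    qed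
    have split: "2 * (2 * of_int a + 1) * of_int N * (legendre_moment a (N - 1) - legendre_moment a (N + 1))
       = 2 * (2 * of_int a + 1) * (of_int N * legendre_moment a (N - 1) - of_int N * legendre_moment a (N + 1))"
      by (simp add: algebra_simps)
    show ?thesis unfolding split unfolding l1 l2 l3 l4 unfolding N a
      by (simp add: algebra_simps)
  qed
  then show "4 * (of_int a + 1) * legendre_moment (a + 1) N + of_int a * legendre_moment (a - 1) N = 2 * (2 * of_int a + 1) * legendre_moment a (N + 1)"
    and "4 * (of_int a + 1) * (of_int a + 2) * legendre_moment (a + 1) N - of_int a * (of_int a - 1) * legendre_moment (a - 1) N
      = 2 * (2 * of_int a + 1) * of_int N * (legendre_moment a (N - 1) - legendre_moment a (N + 1))" by auto
qed

text \<open>The discrete Chebyshev polynomial of degree \<open>a\<close> on $\{0, \dots, d\}$, i.e. the orthogonal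
polynomial for the uniform weight. The sum is, up to a power of 2, the integral of
$P_a(x) (1+x)^l (1-x)^{d-l}$ over $[-1,1]$. Integer indices allow the recurrence
below to start at \<open>a = 0\<close>; the factor \<open>rfact a\<close> makes the function with index $-1$ vanish.\<close>

definition dcheb :: "nat \<Rightarrow> int \<Rightarrow> nat \<Rightarrow> complex" where
  "dcheb d a l = 2 powi (a - int d) * ifact (int d + a + 1) * rfact a / (fact l * fact (d - l)) *
     (\<Sum>N\<le>d. legendre_moment a (int N) * krawtchouk l (d - l) N)"

text \<open>Multiplication by $2l - d$ acts on the Krawtchouk coefficients by \<open>krawtchouk_recurrence\<close>;
shifting the summation index moves this action to the other factor.\<close>

lemma krawtchouk_sum_by_parts:
  fixes L :: "int \<Rightarrow> complex"
  assumes "l \<le> d"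
  shows "(2 * of_nat l - of_nat d) * (\<Sum>N\<le>d. L (int N) * krawtchouk l (d - l) N)
    = (\<Sum>N\<le>d. (of_nat N * L (int N - 1) + (of_nat d - of_nat N) * L (int N + 1)) * krawtchouk l (d - l) N)"
proof -
  define K where "K = krawtchouk l (d - l)"
  define g where "g N = of_nat N * L (int N - 1) * K N" for N
  define h where "h N = (if N = 0 then 0 else L (int N) * (of_nat d + 1 - of_nat N) * K (N - 1))" for N
  have rec: "(2 * of_nat l - of_nat d) * K N
    = of_nat (Suc N) * K (Suc N) + (if N = 0 then 0 else (of_nat d + 1 - of_nat N) * K (N - 1))" for N
    using krawtchouk_recurrence[of l "d - l" N] assms by (simp add: K_def of_nat_diff)
  have top: "K (Suc d) = 0" unfolding K_def by (rule krawtchouk_eq_0) (use assms in simp)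
  have "(2 * of_nat l - of_nat d) * (\<Sum>N\<le>d. L (int N) * K N)
    = (\<Sum>N\<le>d. L (int N) * ((2 * of_nat l - of_nat d) * K N))"
    by (simp add: sum_distrib_left mult.left_commute)
  also have "\<dots> = (\<Sum>N\<le>d. g (Suc N) + h N)"
    unfolding rec by (rule sum.cong) (simp_all add: g_def h_def distrib_left mult.assoc mult.left_commute)
  also have "\<dots> = (\<Sum>N\<le>d. g (Suc N)) + (\<Sum>N\<le>d. h N)"
    by (rule sum.distrib)
  also have "(\<Sum>N\<le>d. g (Suc N)) = (\<Sum>N\<le>Suc d. g N)"
    by (subst sum.atMost_Suc_shift) (simp add: g_def)
  also have "\<dots> = (\<Sum>N\<le>d. g N)"
    by (simp add: g_def top)
  also have "(\<Sum>N\<le>d. h N) = (\<Sum>N\<le>Suc d. h N)"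
    by (simp add: h_def)
  also have "\<dots> = (\<Sum>N\<le>d. h (Suc N))"
    by (subst sum.atMost_Suc_shift) (simp add: h_def)
  also have "(\<Sum>N\<le>d. g N) + (\<Sum>N\<le>d. h (Suc N))
    = (\<Sum>N\<le>d. (of_nat N * L (int N - 1) + (of_nat d - of_nat N) * L (int N + 1)) * K N)"
    unfolding sum.distrib[symmetric]
    by (rule sum.cong) (simp_all add: g_def h_def algebra_simps)
  finally show ?thesis by (simp only: K_def)
qed

lemma dcheb_neg: "a < 0 \<Longrightarrow> dcheb d a l = 0"
  by (simp add: dcheb_def rfact_neg)

text \<open>After summation by parts the claim can be checked for each coefficient \<open>N\<close> separately. It is
then affine in $d$, and its two parts are the relations \<open>legendre_moment_contiguous\<close>.\<close>

lemma dcheb_recurrence: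
  assumes "0 \<le> a" "l \<le> d"
  shows "(of_int a + 1)^2 * dcheb d (a + 1) l + ((of_nat d + 1)^2 - of_int a ^ 2) * dcheb d (a - 1) l
    = (2 * of_int a + 1) * (2 * of_nat l - of_nat d) * dcheb d a l"
proof -
  define a' where "a' = (of_int a :: complex)"
  define d' where "d' = (of_nat d :: complex)"
  define K where "K = krawtchouk l (d - l)"
  define S where "S = (\<lambda>a. \<Sum>N\<le>d. legendre_moment a (int N) * K N)"
  define p where "p = (\<lambda>a. 2 powi (a - int d) * ifact (int d + a + 1) * rfact a / (fact l * fact (d - l)) :: complex)"
  have dcheb: "dcheb d b l = p b * S b" for b by (simp add: dcheb_def p_def S_def K_def)
  have up: "(a' + 1)^2 * p (a + 1) = 2 * (a' + 1) * (d' + a' + 2) * p a"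
  proof -
    have "(2::complex) powi (a + 1 - int d) = 2 * 2 powi (a - int d)"
      using power_int_add_1[of "2::complex" "a - int d"] by (simp add: algebra_simps)
    moreover have "ifact (int d + (a + 1) + 1) = (d' + a' + 2) * ifact (int d + a + 1)"
      using ifact_Suc[of "int d + a + 1"] assms by (simp add: a'_def d'_def add.assoc)
    moreover have "rfact a = (a' + 1) * rfact (a + 1)"
      using rfact_unfold[of a] by (simp add: a'_def)
    ultimately show ?thesis by (simp add: p_def power2_eq_square)
  qed
  have down: "2 * ((d' + 1)^2 - a'^2) * p (a - 1) = a' * (d' + 1 - a') * p a"
  proof -
    have "(2::complex) powi (a - int d) = 2 * 2 powi (a - 1 - int d)"
      using power_int_add_1[of "2::complex" "a - 1 - int d"] by (simp add: algebra_simps)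
    moreover have "ifact (int d + a + 1) = (d' + 1 + a') * ifact (int d + (a - 1) + 1)"
      using ifact_Suc[of "int d + a"] assms by (simp add: a'_def d'_def algebra_simps)
    moreover have "rfact (a - 1) = a' * rfact a"
      using rfact_pred[of a] by (simp add: a'_def)
    moreover have "(d' + 1)^2 - a'^2 = (d' + 1 + a') * (d' + 1 - a')"
      by (simp add: power2_eq_square algebra_simps)
    ultimately show ?thesis by (simp add: p_def)
  qed
  have key: "4 * (a' + 1) * (d' + a' + 2) * S (a + 1) + a' * (d' + 1 - a') * S (a - 1)
      = 2 * (2 * a' + 1) * (2 * of_nat l - d') * S a"
  proof -
    have "4 * (a' + 1) * (d' + a' + 2) * legendre_moment (a + 1) (int N) + a' * (d' + 1 - a') * legendre_moment (a - 1) (int N)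
      = 2 * (2 * a' + 1) * (of_nat N * legendre_moment a (int N - 1) + (d' - of_nat N) * legendre_moment a (int N + 1))" for N
    proof -
      have "4 * (a' + 1) * (d' + a' + 2) * legendre_moment (a + 1) (int N) + a' * (d' + 1 - a') * legendre_moment (a - 1) (int N)
        = d' * (4 * (a' + 1) * legendre_moment (a + 1) (int N) + a' * legendre_moment (a - 1) (int N))
        + (4 * (a' + 1) * (a' + 2) * legendre_moment (a + 1) (int N) - a' * (a' - 1) * legendre_moment (a - 1) (int N))"
        by (simp add: algebra_simps)
      also have "\<dots> = 2 * (2 * a' + 1) * (of_nat N * legendre_moment a (int N - 1) + (d' - of_nat N) * legendre_moment a (int N + 1))"
        using legendre_moment_contiguous[of a "int N"] assms unfolding a'_def by (simp add: algebra_simps)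
      finally show ?thesis .
    qed
    note termwise = this
    have linear: "(\<Sum>N\<le>d. (u * f N + v * g N) * K N) = u * (\<Sum>N\<le>d. f N * K N) + v * (\<Sum>N\<le>d. g N * K N)"
      for u v :: complex and f g
      by (simp add: sum_distrib_left sum.distrib distrib_right mult.assoc)
    have "4 * (a' + 1) * (d' + a' + 2) * S (a + 1) + a' * (d' + 1 - a') * S (a - 1)
      = (\<Sum>N\<le>d. (4 * (a' + 1) * (d' + a' + 2) * legendre_moment (a + 1) (int N) + a' * (d' + 1 - a') * legendre_moment (a - 1) (int N)) * K N)"
      unfolding S_def by (rule linear[symmetric])
    also have "\<dots> = 2 * (2 * a' + 1) * ((2 * of_nat l - d') * S a)"
      unfolding termwise unfolding S_def K_def d'_def krawtchouk_sum_by_parts[OF assms(2)]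
      by (simp only: sum_distrib_left mult.assoc)
    finally show ?thesis by (simp only: mult.assoc)
  qed
  have "2 * ((a' + 1)^2 * (p (a + 1) * S (a + 1)) + ((d' + 1)^2 - a'^2) * (p (a - 1) * S (a - 1)))
      = 2 * ((a' + 1)^2 * p (a + 1)) * S (a + 1) + (2 * ((d' + 1)^2 - a'^2) * p (a - 1)) * S (a - 1)"
    by (simp add: algebra_simps)
  also have "\<dots> = p a * (4 * (a' + 1) * (d' + a' + 2) * S (a + 1) + a' * (d' + 1 - a') * S (a - 1))"
    unfolding up down by (simp add: algebra_simps)
  also have "\<dots> = 2 * ((2 * a' + 1) * (2 * of_nat l - d') * (p a * S a))"
    unfolding key by simp
  finally have "2 * ((a' + 1)^2 * (p (a + 1) * S (a + 1)) + ((d' + 1)^2 - a'^2) * (p (a - 1) * S (a - 1)))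
      = 2 * ((2 * a' + 1) * (2 * of_nat l - d') * (p a * S a))" .
  moreover have "x = y" if "2 * x = 2 * y" for x y :: complex
    using that by simp
  ultimately show ?thesis
    unfolding dcheb a'_def d'_def by blast
qed

lemma dcheb_reflect:
  assumes "l \<le> d"
  shows "dcheb d a (d - l) = (if even a then dcheb d a l else - dcheb d a l)"
proof -
  have "legendre_moment a (int N) * krawtchouk (d - l) l N = (if even a then 1 else -1) * (legendre_moment a (int N) * krawtchouk l (d - l) N)" for N
    by (auto simp: krawtchouk_swap[of "d - l" l] legendre_moment_def minus_one_power_iff)
  then have "(\<Sum>N\<le>d. legendre_moment a (int N) * krawtchouk (d - l) l N)
     = (if even a then 1 else -1) * (\<Sum>N\<le>d. legendre_moment a (int N) * krawtchouk l (d - l) N)"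
    unfolding sum_distrib_left by (rule sum.cong[OF refl])
  with assms show ?thesis by (simp add: dcheb_def mult.commute)
qed

text \<open>The factors $1/(l!\,(d-l)!)$ turn the sum over $l$ into a binomial sum, which leaves only the
moment with \<open>N = 0\<close>.\<close>

lemma dcheb_sum:
  assumes "0 \<le> a"
  shows "(\<Sum>l\<le>d. dcheb d a l) = (if a = 0 then of_nat d + 1 else 0)"
proof -
  define p where "p = 2 powi (a - int d) * ifact (int d + a + 1) * rfact a"
  have "dcheb d a l = (\<Sum>N\<le>d. p / fact d * legendre_moment a (int N) * (of_nat (d choose l) * krawtchouk l (d - l) N))"
    if "l \<le> d" for l
  proof -
    have "of_nat (d choose l) / fact d = (1 / (fact l * fact (d - l)) :: complex)"
      using binomial_fact[OF that, where 'a = complex] by simp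
    then have "dcheb d a l = of_nat (d choose l) / fact d * p * (\<Sum>N\<le>d. legendre_moment a (int N) * krawtchouk l (d - l) N)"
      by (simp add: dcheb_def p_def)
    then show ?thesis by (simp add: sum_distrib_left mult_ac)
  qed
  then have "(\<Sum>l\<le>d. dcheb d a l) = (\<Sum>l\<le>d. \<Sum>N\<le>d. p / fact d * legendre_moment a (int N) * (of_nat (d choose l) * krawtchouk l (d - l) N))"
    by simp
  also have "\<dots> = (\<Sum>N\<le>d. p / fact d * legendre_moment a (int N) * (\<Sum>l\<le>d. of_nat (d choose l) * krawtchouk l (d - l) N))"
    by (subst sum.swap) (simp add: sum_distrib_left)
  also have "\<dots> = (\<Sum>N\<in>{0}. p / fact d * legendre_moment a (int N) * 2 ^ d)"
    unfolding krawtchouk_binomial_sum by (rule sum.mono_neutral_cong_right) auto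
  also have "\<dots> = p * legendre_moment a 0 * 2 ^ d / fact d"
    by simp
  also have "\<dots> = (if a = 0 then of_nat d + 1 else 0)"
  proof (cases "a = 0")
    case True
    have "nat (int d + 1) = Suc d" by simp
    then show ?thesis using True
      by (simp add: p_def legendre_moment_def rfact_def power_int_minus field_simps)
  next
    case False
    have "legendre_moment a 0 = 0"
    proof (cases "even a")
      case True
      with assms False have "(0 - a) div 2 < 0" by presburger
      then show ?thesis by (simp add: legendre_moment_def rfact_neg)
    qed (simp add: legendre_moment_def)
    with False show ?thesis by simp
  qed
  finally show ?thesis .
qed

text \<open>This is the Beta integral of $(1+x)^l (1-x)^{d-l}$. Integration by parts shows that the value does
not depend on $l$, and \<open>dcheb_sum\<close> gives the sum of all values.\<close>

lemma dcheb_0: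
  assumes "l \<le> d"
  shows "dcheb d 0 l = 1"
proof -
  have moment0: "legendre_moment 0 (int N) = (if even N then 1 / of_nat (Suc N) else 0)" for N
  proof -
    have "nat (int N + 1) = Suc N" by simp
    then show ?thesis by (auto simp: legendre_moment_def rfact_def)
  qed
  have step: "dcheb d 0 (Suc l) = dcheb d 0 l" if "l < d" for l
  proof -
    define m where "m = d - Suc l"
    have m: "d - l = Suc m" "d - Suc l = m" "d = Suc (l + m)" using that by (auto simp: m_def)
    define c where "c = (\<lambda>N. if even N then 1 / of_nat (Suc N) else 0 :: complex)"
    have "of_nat (Suc l) * (\<Sum>N\<le>d. c N * krawtchouk l (Suc m) N) - of_nat (Suc m) * (\<Sum>N\<le>d. c N * krawtchouk (Suc l) m N)
      = (\<Sum>N\<le>d. c N * (of_nat (Suc l) * krawtchouk l (Suc m) N - of_nat (Suc m) * krawtchouk (Suc l) m N))"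
      by (simp add: sum_distrib_left sum_subtractf right_diff_distrib mult.left_commute del: of_nat_Suc)
    also have "\<dots> = (\<Sum>N\<le>d. c N * (of_nat (Suc N) * krawtchouk (Suc l) (Suc m) (Suc N)))"
      using krawtchouk_lower[of "Suc l" "Suc m"] by simp
    also have "\<dots> = (\<Sum>N | N < Suc l + Suc m \<and> even N. krawtchouk (Suc l) (Suc m) (Suc N))"
      by (rule sum.mono_neutral_cong_right) (auto simp: c_def m simp del: of_nat_Suc)
    also have "\<dots> = 0" by (rule krawtchouk_odd_sum) auto
    finally have sums: "of_nat (Suc l) * (\<Sum>N\<le>d. c N * krawtchouk l (Suc m) N) = of_nat (Suc m) * (\<Sum>N\<le>d. c N * krawtchouk (Suc l) m N)"
      by simp
    have cross: "p / (fact (Suc l) * fact m) * s' = p / (fact l * fact (Suc m)) * s"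
      if "of_nat (Suc l) * s = of_nat (Suc m) * s'" for p s s' :: complex
      using that by (simp add: field_simps del: of_nat_Suc)
    have legendre_moment_c: "legendre_moment 0 (int N) = c N" for N by (simp add: moment0 c_def)
    show ?thesis unfolding dcheb_def m(1,2) legendre_moment_c by (rule cross[OF sums])
  qed
  have const: "l \<le> d \<Longrightarrow> dcheb d 0 l = dcheb d 0 0" for l
  proof (induction l)
    case (Suc l)
    then show ?case using step[of l] by simp
  qed simp
  have "(of_nat d + 1) * dcheb d 0 0 = (\<Sum>l\<le>d. dcheb d 0 0)"
    by simp
  also have "\<dots> = (\<Sum>l\<le>d. dcheb d 0 l)"
    by (rule sum.cong[OF refl], rule const[symmetric]) simp
  also have "\<dots> = of_nat d + 1"
    using dcheb_sum[of 0 d] by simp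
  finally have "(of_nat d + 1) * dcheb d 0 0 = of_nat d + 1" .
  moreover have "of_nat d + 1 \<noteq> (0 :: complex)"
    using of_nat_neq_0[of d, where 'a = complex] by (simp add: add.commute)
  ultimately have "dcheb d 0 0 = 1" by simp
  with const[OF assms] show ?thesis by simp
qed

section \<open>Racah sums and their contiguous relation\<close>

text \<open>The summand of the third factor of \<open>omega\<close> at the parameters that occur in the system; it is
symmetric in \<open>a\<close>, \<open>b\<close>, \<open>c\<close>.\<close>

definition racah_term :: "int \<Rightarrow> int \<Rightarrow> int \<Rightarrow> int \<Rightarrow> int \<Rightarrow> complex" where
  "racah_term d a b c z = (-1) powi z * ifact (z + 1) *
     (rfact (z - a - b - c) * rfact (z - a - d) * rfact (z - b - d) * rfact (z - c - d) *
      rfact (d + a + b - z) * rfact (d + a + c - z) * rfact (d + b + c - z))"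

definition racah_sum :: "int \<Rightarrow> int \<Rightarrow> int \<Rightarrow> int \<Rightarrow> complex" where
  "racah_sum d a b c = (\<Sum>z\<in>{0..d + a + b + c}. racah_term d a b c z)"

text \<open>The polynomial identity behind the contiguous relation of the Racah sums. An unknown polynomial
\<open>y\<close> of degree 2 in \<open>z\<close> makes it a system of linear equations for three coefficients, and the solution turns out to be
polynomial in the parameters as well.\<close>

lemma racah_certificate_identity:
  fixes a b c d z :: complex
  defines "s \<equiv> a + b + c"
  defines "X \<equiv> z - s" and "A \<equiv> z - a - d" and "B \<equiv> z - b - d" and "C \<equiv> z - c - d"
      and "P \<equiv> d + a + b - z" and "Q \<equiv> d + a + c - z" and "R \<equiv> d + b + c - z"
  defines "y \<equiv> \<lambda>z. (b - c) * (- 2 * (d + 1) * (s + 2) * (z - a - d) * (d + b + c - z) +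
             (b + c - a + 2 * b * c) * ((d - b - c) * (b + c - a) + 2 * (b + c + 1) * (z - a - d)))"
  shows "(2 * c + 1) * ((b + 1)^2 * (b + c - a) * (a + b - c) * ((z + 2) * (X + 1) * (B + 1) * Q)
                    + (s + 2) * ((d + 1)^2 - b^2) * (a + c - b) * ((A + 1) * (C + 1) * P * R))
       - (2 * b + 1) * ((c + 1)^2 * (b + c - a) * (a + c - b) * ((z + 2) * (X + 1) * (C + 1) * P)
                    + (s + 2) * ((d + 1)^2 - c^2) * (a + b - c) * ((A + 1) * (B + 1) * Q * R))
       = - (z + 2) * P * Q * R * y (z + 1) - (X + 1) * (A + 1) * (B + 1) * (C + 1) * y z"
  unfolding assms by (simp only: power2_eq_square) Groebner_Basis.algebra

definition racah_certificate :: "complex \<Rightarrow> complex \<Rightarrow> complex \<Rightarrow> complex \<Rightarrow> complex \<Rightarrow> complex" where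
  "racah_certificate d a b c z =
     (b - c) * (- 2 * (d + 1) * (a + b + c + 2) * (z - a - d) * (d + b + c - z) +
       (b + c - a + 2 * b * c) * ((d - b - c) * (b + c - a) + 2 * (b + c + 1) * (z - a - d)))"

text \<open>The four neighbours of the triple \<open>(a, b, c)\<close> enter the relation with summands that are polynomial
multiples of one common product \<open>base\<close>. The terms with \<open>b + 1\<close> and \<open>c + 1\<close> are taken at \<open>z + 1\<close>, which keeps these
multiples of degree four.\<close>

lemma racah_term_telescopes:
  fixes a b c d z :: int
  assumes z: "0 \<le> z"
  defines "a' \<equiv> of_int a :: complex" and "b' \<equiv> of_int b :: complex" and "c' \<equiv> of_int c :: complex"
    and "d' \<equiv> of_int d :: complex"
  defines "H \<equiv> \<lambda>z. racah_term d a b c z * racah_certificate d' a' b' c' (of_int z)"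
  shows "(2 * c' + 1) * (- ((b' + 1)^2 * (b' + c' - a') * (a' + b' - c') * racah_term d a (b + 1) c (z + 1))
                    + (a' + b' + c' + 2) * ((d' + 1)^2 - b'^2) * (a' + c' - b') * racah_term d a (b - 1) c z)
       - (2 * b' + 1) * (- ((c' + 1)^2 * (b' + c' - a') * (a' + c' - b') * racah_term d a b (c + 1) (z + 1))
                    + (a' + b' + c' + 2) * ((d' + 1)^2 - c'^2) * (a' + b' - c') * racah_term d a b (c - 1) z)
       = H (z + 1) - H z"
proof -
  define X A B C P Q R where "X = z - a - b - c" and "A = z - a - d" and "B = z - b - d"
    and "C = z - c - d" and "P = d + a + b - z" and "Q = d + a + c - z" and "R = d + b + c - z"
  note defs = X_def A_def B_def C_def P_def Q_def R_def
  define base where "base = (-1) powi z * ifact (z + 1) *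
     (rfact (X + 1) * rfact (A + 1) * rfact (B + 1) * rfact (C + 1) * rfact P * rfact Q * rfact R)"
  define z' where "z' = (of_int z :: complex)"
  have sgn: "(-1 :: complex) powi (z + 1) = - ((-1) powi z)"
    by (simp add: power_int_add_1)
  have fz: "ifact (z + 2) = (z' + 2) * ifact (z + 1)"
    using ifact_Suc[of "z + 1"] z by (simp add: z'_def add.assoc)
  have t1: "racah_term d a (b + 1) c (z + 1) = (-1) powi (z + 1) * ifact (z + 2) *
      (rfact X * rfact (A + 1) * rfact B * rfact (C + 1) * rfact P * rfact (Q - 1) * rfact R)"
    unfolding racah_term_def defs by (simp add: algebra_simps)
  have t2: "racah_term d a b (c + 1) (z + 1) = (-1) powi (z + 1) * ifact (z + 2) *
      (rfact X * rfact (A + 1) * rfact (B + 1) * rfact C * rfact (P - 1) * rfact Q * rfact R)"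
    unfolding racah_term_def defs by (simp add: algebra_simps)
  have t3: "racah_term d a (b - 1) c z = (-1) powi z * ifact (z + 1) *
      (rfact (X + 1) * rfact A * rfact (B + 1) * rfact C * rfact (P - 1) * rfact Q * rfact (R - 1))"
    unfolding racah_term_def defs by (simp add: algebra_simps)
  have t4: "racah_term d a b (c - 1) z = (-1) powi z * ifact (z + 1) *
      (rfact (X + 1) * rfact A * rfact B * rfact (C + 1) * rfact P * rfact (Q - 1) * rfact (R - 1))"
    unfolding racah_term_def defs by (simp add: algebra_simps)
  have t5: "racah_term d a b c (z + 1) = (-1) powi (z + 1) * ifact (z + 2) *
      (rfact (X + 1) * rfact (A + 1) * rfact (B + 1) * rfact (C + 1) * rfact (P - 1) * rfact (Q - 1) * rfact (R - 1))"
    unfolding racah_term_def defs by (simp add: algebra_simps)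
  have t6: "racah_term d a b c z = (-1) powi z * ifact (z + 1) *
      (rfact X * rfact A * rfact B * rfact C * rfact P * rfact Q * rfact R)"
    unfolding racah_term_def defs by (simp add: algebra_simps)
  note unf = rfact_unfold[of X] rfact_unfold[of A] rfact_unfold[of B] rfact_unfold[of C]
    rfact_pred[of P] rfact_pred[of Q] rfact_pred[of R] sgn fz
  define X' A' B' C' P' Q' R' where "X' = z' - (a' + b' + c')" and "A' = z' - a' - d'"
    and "B' = z' - b' - d'" and "C' = z' - c' - d'" and "P' = d' + a' + b' - z'"
    and "Q' = d' + a' + c' - z'" and "R' = d' + b' + c' - z'"
  note defs' = X'_def A'_def B'_def C'_def P'_def Q'_def R'_def z'_def a'_def b'_def c'_def d'_def
  have conv: "of_int (X + 1) = X' + 1" "of_int (A + 1) = A' + 1" "of_int (B + 1) = B' + 1"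
    "of_int (C + 1) = C' + 1" "of_int P = P'" "of_int Q = Q'" "of_int R = R'"
    by (simp_all add: defs defs')
  have u1: "racah_term d a (b + 1) c (z + 1) = - ((z' + 2) * (X' + 1) * (B' + 1) * Q') * base"
    unfolding t1 base_def unf conv by (simp only: mult_minus_left mult_minus_right ac_simps)
  have u2: "racah_term d a b (c + 1) (z + 1) = - ((z' + 2) * (X' + 1) * (C' + 1) * P') * base"
    unfolding t2 base_def unf conv by (simp only: mult_minus_left mult_minus_right ac_simps)
  have u3: "racah_term d a (b - 1) c z = ((A' + 1) * (C' + 1) * P' * R') * base"
    unfolding t3 base_def unf conv by (simp only: ac_simps)
  have u4: "racah_term d a b (c - 1) z = ((A' + 1) * (B' + 1) * Q' * R') * base"
    unfolding t4 base_def unf conv by (simp only: ac_simps)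
  have u5: "racah_term d a b c (z + 1) = - ((z' + 2) * P' * Q' * R') * base"
    unfolding t5 base_def unf conv by (simp only: mult_minus_left mult_minus_right ac_simps)
  have u6: "racah_term d a b c z = ((X' + 1) * (A' + 1) * (B' + 1) * (C' + 1)) * base"
    unfolding t6 base_def unf conv by (simp only: ac_simps)
  define y where "y = (\<lambda>z. racah_certificate d' a' b' c' z)"
  define L where "L = (2 * c' + 1) * ((b' + 1)^2 * (b' + c' - a') * (a' + b' - c') * ((z' + 2) * (X' + 1) * (B' + 1) * Q')
                    + (a' + b' + c' + 2) * ((d' + 1)^2 - b'^2) * (a' + c' - b') * ((A' + 1) * (C' + 1) * P' * R'))
       - (2 * b' + 1) * ((c' + 1)^2 * (b' + c' - a') * (a' + c' - b') * ((z' + 2) * (X' + 1) * (C' + 1) * P')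
                    + (a' + b' + c' + 2) * ((d' + 1)^2 - c'^2) * (a' + b' - c') * ((A' + 1) * (B' + 1) * Q' * R'))"
  have cert: "L = - (z' + 2) * P' * Q' * R' * y (z' + 1) - (X' + 1) * (A' + 1) * (B' + 1) * (C' + 1) * y z'"
    unfolding L_def y_def racah_certificate_def X'_def A'_def B'_def C'_def P'_def Q'_def R'_def
    by (rule racah_certificate_identity)
  have "H (z + 1) - H z = (- (z' + 2) * P' * Q' * R' * y (z' + 1) - (X' + 1) * (A' + 1) * (B' + 1) * (C' + 1) * y z') * base"
    unfolding H_def u5 u6 y_def z'_def by (simp add: algebra_simps)
  also have "\<dots> = L * base" by (simp only: cert)
  finally have HL: "H (z + 1) - H z = L * base" .
  have collect: "p * (- (k1 * (- m1 * base)) + k2 * (m3 * base)) - r * (- (k3 * (- m2 * base)) + k4 * (m4 * base))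
      = (p * (k1 * m1 + k2 * m3) - r * (k3 * m2 + k4 * m4)) * base" for p r k1 k2 k3 k4 m1 m2 m3 m4
    by (simp add: algebra_simps)
  show ?thesis
    unfolding u1 u2 u3 u4 HL L_def by (rule collect)
qed

text \<open>The sum over \<open>z\<close> of \<open>racah_term_telescopes\<close>: the boundary terms vanish because of the reciprocal
factorials.\<close>

lemma racah_sum_recurrence:
  fixes a b c d :: int
  assumes nonneg: "0 \<le> a" "0 \<le> b" "0 \<le> c" "0 \<le> d" "1 \<le> a + b + c"
  defines "a' \<equiv> of_int a :: complex" and "b' \<equiv> of_int b :: complex" and "c' \<equiv> of_int c :: complex"
    and "d' \<equiv> of_int d :: complex"
  shows "(2 * c' + 1) * (- ((b' + 1)^2 * (b' + c' - a') * (a' + b' - c') * racah_sum d a (b + 1) c)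
            + (a' + b' + c' + 2) * ((d' + 1)^2 - b'^2) * (a' + c' - b') * racah_sum d a (b - 1) c)
       = (2 * b' + 1) * (- ((c' + 1)^2 * (b' + c' - a') * (a' + c' - b') * racah_sum d a b (c + 1))
            + (a' + b' + c' + 2) * ((d' + 1)^2 - c'^2) * (a' + b' - c') * racah_sum d a b (c - 1))"
proof -
  define M where "M = d + a + b + c"
  define H where "H = (\<lambda>z. racah_term d a b c z * racah_certificate d' a' b' c' (of_int z))"
  have telescope: "(\<Sum>z\<in>{0..N}. H (z + 1) - H z) = H (N + 1) - H 0" if "0 \<le> N" for N
    using that
  proof (induction N rule: int_ge_induct)
    case (step i)
    then have "{0..i + 1} = insert (i + 1) {0..i}" by auto
    with step show ?case by simp
  qed simp
  have up: "(\<Sum>z\<in>{0..M}. racah_term d x y w (z + 1)) = racah_sum d x y w"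
    if "x + y + w = a + b + c + 1" for x y w
  proof -
    have "(\<Sum>z\<in>{0..M}. racah_term d x y w (z + 1)) = (\<Sum>z\<in>{1..M + 1}. racah_term d x y w z)"
      by (rule sum.reindex_bij_witness[of _ "\<lambda>z. z - 1" "\<lambda>z. z + 1"]) auto
    also have "\<dots> = (\<Sum>z\<in>{0..M + 1}. racah_term d x y w z)"
      by (rule sum.mono_neutral_left) (use that nonneg in \<open>auto simp: racah_term_def rfact_neg\<close>)
    also have "M + 1 = d + x + y + w"
      using that by (simp add: M_def)
    finally show ?thesis by (simp add: racah_sum_def)
  qed
  have down: "(\<Sum>z\<in>{0..M}. racah_term d x y w z) = racah_sum d x y w"
    if "x + y + w = a + b + c - 1" "0 \<le> y \<or> 0 \<le> w" for x y w
    unfolding racah_sum_def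
    by (rule sum.mono_neutral_right)
       (use that nonneg in \<open>auto simp: M_def racah_term_def intro!: rfact_neg\<close>)
  have H0: "H 0 = 0" using nonneg by (simp add: H_def racah_term_def rfact_neg)
  have HM: "H (M + 1) = 0" using nonneg by (simp add: H_def racah_term_def rfact_neg M_def)
  have "(\<Sum>z\<in>{0..M}. (2 * c' + 1) * (- ((b' + 1)^2 * (b' + c' - a') * (a' + b' - c') * racah_term d a (b + 1) c (z + 1))
                    + (a' + b' + c' + 2) * ((d' + 1)^2 - b'^2) * (a' + c' - b') * racah_term d a (b - 1) c z)
       - (2 * b' + 1) * (- ((c' + 1)^2 * (b' + c' - a') * (a' + c' - b') * racah_term d a b (c + 1) (z + 1))
                    + (a' + b' + c' + 2) * ((d' + 1)^2 - c'^2) * (a' + b' - c') * racah_term d a b (c - 1) z))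
      = (\<Sum>z\<in>{0..M}. H (z + 1) - H z)"
    unfolding H_def a'_def b'_def c'_def d'_def
    by (rule sum.cong[OF refl]) (rule racah_term_telescopes, simp)
  also have "\<dots> = 0"
    using nonneg by (subst telescope) (simp_all add: H0 HM, simp add: M_def)
  finally show ?thesis
    using up[of a "b + 1" c] up[of a b "c + 1"] down[of a "b - 1" c] down[of a b "c - 1"] nonneg
    by (simp add: sum.distrib sum_subtractf sum_negf sum_distrib_left[symmetric])
qed

text \<open>The ratio $(2m)!/m!$, extended to negative \<open>m\<close> in the only way that preserves
\<open>fact_ratio_Suc\<close>. The extension matters at the boundary of the triangle inequalities, where
\<open>triple_value_recurrence\<close> involves neighbours outside the triangle.\<close>

definition fact_ratio :: "int \<Rightarrow> complex" where
  "fact_ratio m = (if 0 \<le> m then ifact (2 * m) / ifact m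
            else (-1) ^ nat (- m) * ifact (- m) / ifact (- 2 * m))"

lemma fact_ratio_Suc: "fact_ratio (m + 1) = 2 * (2 * of_int m + 1) * fact_ratio m"
proof -
  have fact2: "fact (2 * Suc k) = (2 * complex_of_nat k + 2) * (2 * of_nat k + 1) * fact (2 * k)" for k
    by (simp add: algebra_simps)
  consider (nonneg) k where "m = int k" | (neg) k where "m = - int (Suc k)"
    by (metis int_cases)
  then show ?thesis
  proof cases
    case nonneg
    have *: "nat (2 * (int k + 1)) = 2 * Suc k" "nat (2 * int k + 2) = 2 * Suc k" "nat (int k + 1) = Suc k" "nat (2 * int k) = 2 * k" by auto
    have "fact_ratio (m + 1) = fact (2 * Suc k) / fact (Suc k)"
      by (simp add: fact_ratio_def nonneg * del: fact_Suc mult_Suc_right)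
    also have "\<dots> = 2 * (2 * of_nat k + 1) * (fact (2 * k) / fact k)"
    proof -
      have "(2 * K + 2) * (2 * K + 1) * E / ((1 + K) * F) = 2 * (2 * K + 1) * (E / F)"
        if "1 + K \<noteq> 0" for K E F :: complex
      proof -
        have "(2 * K + 2) * (2 * K + 1) * E / ((1 + K) * F) = (1 + K) * (2 * (2 * K + 1) * E) / ((1 + K) * F)"
          by (simp add: algebra_simps)
        with that show ?thesis by simp
      qed
      from this[of "of_nat k"] show ?thesis
        using of_nat_neq_0[of k, where 'a = complex] unfolding fact2 by simp
    qed
    finally show ?thesis by (simp add: fact_ratio_def nonneg *)
  next
    case neg
    have *: "nat (2 * int k) = 2 * k" "nat (2 * (1 + int k)) = 2 * Suc k"  "nat (2 + 2 * int k) = 2 * Suc k" 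
        "nat (1 + int k) = Suc k" "nat (int k + 1) = Suc k" "nat (2 * int k + 2) = 2 * Suc k" by auto
    have "fact_ratio (m + 1) = (-1) ^ k * fact k / fact (2 * k)"
    proof -
      have "m + 1 = - int k" by (simp add: neg)
      then show ?thesis by (cases "k = 0") (simp_all add: fact_ratio_def *)
    qed
    moreover have "fact_ratio m = (-1) ^ Suc k * fact (Suc k) / fact (2 * Suc k)"
      by (simp add: fact_ratio_def neg * del: fact_Suc mult_Suc_right)
    moreover have "S * F / E = 2 * (2 * (- (1 + K)) + 1) * (- S * ((1 + K) * F) / ((2 * K + 2) * (2 * K + 1) * E))"
      if "1 + K \<noteq> 0" "2 * K + 1 \<noteq> 0" "E \<noteq> 0" for S F E K :: complex
    proof -
      have "2 * (2 * (- (1 + K)) + 1) * (- S * ((1 + K) * F) / ((2 * K + 2) * (2 * K + 1) * E))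
        = (2 * (1 + K) * (2 * K + 1)) * (S * F) / ((2 * (1 + K) * (2 * K + 1)) * E)"
        by (simp add: algebra_simps)
      also have "\<dots> = S * F / E"
        by (rule mult_divide_mult_cancel_left) (use that in \<open>simp only: mult_eq_0_iff de_Morgan_disj\<close>, simp)
      finally show ?thesis by (rule sym)
    qed
    from this[of "of_nat k" "fact (2 * k)" "(-1) ^ k" "fact k"]
    have "(-1) ^ k * fact k / fact (2 * k)
      = 2 * (2 * (- (1 + of_nat k)) + 1) * (- ((-1) ^ k) * ((1 + of_nat k) * fact k) /
          ((2 * of_nat k + 2) * (2 * of_nat k + 1) * fact (2 * k) :: complex))"
      using of_nat_neq_0[of k, where 'a = complex] of_nat_neq_0[of "2 * k", where 'a = complex]
      by (simp add: add.commute)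
    ultimately show ?thesis unfolding fact2 by (simp add: neg)
  qed
qed

text \<open>For an even sum \<open>a + b + c\<close> within the triangle inequalities, this is the absolute value of the
Wigner 3j symbol with vanishing lower entries, times the triangle coefficient.\<close>

definition tri_factor :: "int \<Rightarrow> int \<Rightarrow> int \<Rightarrow> complex" where
  "tri_factor a b c = (let g = (a + b + c) div 2 in
     ifact g / ifact (2 * g + 1) * (fact_ratio (g - a) * fact_ratio (g - b) * fact_ratio (g - c)))"

text \<open>The value of the sum over $l$ of the product of the discrete Chebyshev polynomials of degrees
\<open>a\<close>, \<open>b\<close>, \<open>c\<close> with even sum, see \<open>triple_sum\<close>.\<close>

definition triple_value :: "int \<Rightarrow> int \<Rightarrow> int \<Rightarrow> int \<Rightarrow> complex" where
  "triple_value d a b c =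
     (-1) powi (d + (a + b + c) div 2) * tri_factor a b c * racah_sum d a b c"

lemma racah_sum_swap12: "racah_sum d a b c = racah_sum d b a c"
  unfolding racah_sum_def racah_term_def by (simp add: algebra_simps)

lemma racah_sum_swap23: "racah_sum d a b c = racah_sum d a c b"
  unfolding racah_sum_def racah_term_def by (simp add: algebra_simps)

lemma triple_value_swap12: "triple_value d a b c = triple_value d b a c"
  unfolding triple_value_def tri_factor_def
  by (subst racah_sum_swap12) (simp add: Let_def add.commute mult.commute)

lemma triple_value_swap23: "triple_value d a b c = triple_value d a c b"
  unfolding triple_value_def tri_factor_def
  by (subst racah_sum_swap23) (simp add: Let_def algebra_simps)

text \<open>The factor \<open>tri_factor\<close> changes by odd linear factors when one index moves by one, and these are the factors
in \<open>racah_sum_recurrence\<close>.\<close>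

lemma triple_value_recurrence:
  fixes a b c d :: int
  assumes nonneg: "0 \<le> a" "0 \<le> b" "0 \<le> c" "0 \<le> d" and odd: "odd (a + b + c)"
  defines "b' \<equiv> of_int b :: complex" and "c' \<equiv> of_int c :: complex" and "d' \<equiv> of_int d :: complex"
  shows "(2 * c' + 1) * ((b' + 1)^2 * triple_value d a (b + 1) c
            + ((d' + 1)^2 - b'^2) * triple_value d a (b - 1) c)
       = (2 * b' + 1) * ((c' + 1)^2 * triple_value d a b (c + 1)
            + ((d' + 1)^2 - c'^2) * triple_value d a b (c - 1))"
proof -
  obtain g where g: "a + b + c = 2 * g + 1" using odd by (elim oddE)
  with nonneg have "0 \<le> g" by presburger
  define a' where "a' = (of_int a :: complex)"
  define s' where "s' = a' + b' + c'"
  define base where "base = (-1) powi (d + g) * (ifact g / ifact (2 * g + 1)) *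
      (fact_ratio (g - a) * fact_ratio (g - b) * fact_ratio (g - c))"
  have s': "s' = 2 * of_int g + 1"
    using arg_cong[OF g, of "of_int :: int \<Rightarrow> complex"] by (simp add: s'_def a'_def b'_def c'_def)
  have abc: "fact_ratio (g - a + 1) = 2 * (b' + c' - a') * fact_ratio (g - a)"
    "fact_ratio (g - b + 1) = 2 * (a' + c' - b') * fact_ratio (g - b)"
    "fact_ratio (g - c + 1) = 2 * (a' + b' - c') * fact_ratio (g - c)"
  proof -
    have "2 * of_int (g - x) + 1 = s' - 2 * of_int x" for x
      by (simp add: s')
    then show "fact_ratio (g - a + 1) = 2 * (b' + c' - a') * fact_ratio (g - a)"
      "fact_ratio (g - b + 1) = 2 * (a' + c' - b') * fact_ratio (g - b)"
      "fact_ratio (g - c + 1) = 2 * (a' + b' - c') * fact_ratio (g - c)"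
      by (simp_all only: fact_ratio_Suc) (simp_all add: s'_def a'_def b'_def c'_def)
  qed
  have "s' + 2 = of_int (2 * g + 3)" by (simp add: s')
  also have "of_int (2 * g + 3) \<noteq> (0 :: complex)"
    using \<open>0 \<le> g\<close> by (simp only: of_int_eq_0_iff)
  finally have s2: "s' + 2 \<noteq> 0" .
  have ratio: "ifact (g + 1) / ifact (2 * (g + 1) + 1) = ifact g / ifact (2 * g + 1) / (2 * (s' + 2))"
  proof -
    have "ifact (2 * (g + 1) + 1) = ifact ((2 * g + 2) + 1)"
      by (simp add: algebra_simps)
    also have "\<dots> = of_int (2 * g + 2 + 1) * ifact ((2 * g + 1) + 1)"
      using \<open>0 \<le> g\<close> by (subst ifact_Suc) (simp_all add: add.assoc)
    also have "\<dots> = of_int (2 * g + 2 + 1) * (of_int (2 * g + 1 + 1) * ifact (2 * g + 1))"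
      using \<open>0 \<le> g\<close> by (subst ifact_Suc[of "2 * g + 1"]) simp_all
    also have "\<dots> = (s' + 2) * (2 * of_int (g + 1) * ifact (2 * g + 1))"
      by (simp add: s' add.assoc)
    finally have den: "ifact (2 * (g + 1) + 1) = (s' + 2) * (2 * of_int (g + 1) * ifact (2 * g + 1))" .
    have num: "ifact (g + 1) = of_int (g + 1) * ifact g"
      using \<open>0 \<le> g\<close> by (rule ifact_Suc)
    have "of_int (g + 1) \<noteq> (0 :: complex)"
      using \<open>0 \<le> g\<close> by (simp only: of_int_eq_0_iff)
    moreover have "G * F / (u * (2 * G * E)) = F / E / (2 * u)" if "G \<noteq> 0" for G F u E :: complex
      using that by simp
    ultimately show ?thesis unfolding num den by blast
  qed
  have sgn: "(-1 :: complex) powi (d + (g + 1)) = - ((-1) powi (d + g))"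
    by (simp add: add.assoc[symmetric] power_int_add_1)
  have half: "(a + (b + 1) + c) div 2 = g + 1" "(a + b + (c + 1)) div 2 = g + 1"
    "(a + (b - 1) + c) div 2 = g" "(a + b + (c - 1)) div 2 = g"
    using g by presburger+
  have shift: "g + 1 - (b + 1) = g - b" "g + 1 - (c + 1) = g - c" "g - (b - 1) = g - b + 1"
     "g - (c - 1) = g - c + 1" "g + 1 - a = g - a + 1" "g + 1 - b = g - b + 1" "g + 1 - c = g - c + 1"
    by simp_all
  have collect: "u * (- \<sigma> * (q / (2 * u) * ((2 * x * D) * D' * (2 * y * D''))) * w)
      = - (2 * (\<sigma> * q * (D * D' * D'')) * (x * y * w))"
    "u * (- \<sigma> * (q / (2 * u) * ((2 * x * D) * (2 * y * D') * D'')) * w)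
      = - (2 * (\<sigma> * q * (D * D' * D'')) * (x * y * w))"
    if "u \<noteq> 0" for u \<sigma> q x y D D' D'' w :: complex
    using that by (simp_all add: field_simps)
  have v1: "(s' + 2) * triple_value d a (b + 1) c
     = - (2 * base * ((b' + c' - a') * (a' + b' - c') * racah_sum d a (b + 1) c))"
    unfolding triple_value_def tri_factor_def Let_def half sgn shift ratio abc base_def
    by (rule collect(1)[OF s2])
  have v2: "(s' + 2) * triple_value d a b (c + 1)
     = - (2 * base * ((b' + c' - a') * (a' + c' - b') * racah_sum d a b (c + 1)))"
    unfolding triple_value_def tri_factor_def Let_def half sgn shift ratio abc base_def
    by (rule collect(2)[OF s2])
  have v3: "triple_value d a (b - 1) c = 2 * base * ((a' + c' - b') * racah_sum d a (b - 1) c)"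
    unfolding triple_value_def tri_factor_def Let_def half shift abc base_def by simp
  have v4: "triple_value d a b (c - 1) = 2 * base * ((a' + b' - c') * racah_sum d a b (c - 1))"
    unfolding triple_value_def tri_factor_def Let_def half shift abc base_def by simp
  have factor: "k * (m * (- (2 * p * (x * y * v))) + t * e * (2 * p * (u * w)))
      = 2 * p * (k * (- (m * x * y * v) + t * e * u * w))" for k m p x y v t e u w :: complex
    by (simp add: algebra_simps)
  have "(s' + 2) * ((2 * c' + 1) * ((b' + 1)^2 * triple_value d a (b + 1) c
            + ((d' + 1)^2 - b'^2) * triple_value d a (b - 1) c))
      = (2 * c' + 1) * ((b' + 1)^2 * ((s' + 2) * triple_value d a (b + 1) c)
            + (s' + 2) * ((d' + 1)^2 - b'^2) * triple_value d a (b - 1) c)"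
    by (simp add: algebra_simps)
  also have "\<dots> = 2 * base * ((2 * c' + 1) * (- ((b' + 1)^2 * (b' + c' - a') * (a' + b' - c') * racah_sum d a (b + 1) c)
            + (a' + b' + c' + 2) * ((d' + 1)^2 - b'^2) * (a' + c' - b') * racah_sum d a (b - 1) c))"
    unfolding v1 v3 unfolding s'_def by (rule factor)
  also have "\<dots> = 2 * base * ((2 * b' + 1) * (- ((c' + 1)^2 * (b' + c' - a') * (a' + c' - b') * racah_sum d a b (c + 1))
            + (a' + b' + c' + 2) * ((d' + 1)^2 - c'^2) * (a' + b' - c') * racah_sum d a b (c - 1)))"
    using racah_sum_recurrence[of a b c d] nonneg g \<open>0 \<le> g\<close>
    unfolding a'_def b'_def c'_def d'_def by simp
  also have "\<dots> = (2 * b' + 1) * ((c' + 1)^2 * ((s' + 2) * triple_value d a b (c + 1))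
            + (s' + 2) * ((d' + 1)^2 - c'^2) * triple_value d a b (c - 1))"
    unfolding v2 v4 unfolding s'_def by (rule factor[symmetric])
  also have "\<dots> = (s' + 2) * ((2 * b' + 1) * ((c' + 1)^2 * triple_value d a b (c + 1)
            + ((d' + 1)^2 - c'^2) * triple_value d a b (c - 1)))"
    by (simp add: algebra_simps)
  finally show ?thesis using s2 by simp
qed

lemma racah_sum_large:
  assumes "0 \<le> a" "0 \<le> b" "0 \<le> c" "0 \<le> d" "a + b < c"
  shows "racah_sum d a b c = 0"
  unfolding racah_sum_def racah_term_def
proof (intro sum.neutral ballI)
  fix z
  consider "z - a - b - c < 0" | "z - c - d < 0" | "d + a + b - z < 0"
    using assms by linarith
  then show "(- 1) powi z * ifact (z + 1) *
         (rfact (z - a - b - c) * rfact (z - a - d) * rfact (z - b - d) * rfact (z - c - d) *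
          rfact (d + a + b - z) * rfact (d + a + c - z) * rfact (d + b + c - z)) = 0"
    by cases (simp_all add: rfact_neg)
qed

lemma racah_sum_negative:
  assumes "b < 0"
  shows "racah_sum d a b c = 0"
  unfolding racah_sum_def racah_term_def
proof (intro sum.neutral ballI)
  fix z
  consider "z - a - d < 0" | "d + a + b - z < 0"
    using assms by linarith
  then show "(- 1) powi z * ifact (z + 1) *
         (rfact (z - a - b - c) * rfact (z - a - d) * rfact (z - b - d) * rfact (z - c - d) *
          rfact (d + a + b - z) * rfact (d + a + c - z) * rfact (d + b + c - z)) = 0"
    by cases (simp_all add: rfact_neg)
qed

text \<open>The bounds for \<open>z\<close> leave only \<open>z = a + d = b + d\<close>.\<close>

lemma racah_sum_0:
  assumes "0 \<le> a" "0 \<le> b" "0 \<le> d"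
  shows "racah_sum d a b 0 = (if a = b then (-1) powi (d + a) * ifact (d + a + 1) * rfact (d - a) * rfact a ^ 2 else 0)"
proof -
  have zero: "racah_term d a b 0 z = 0" if "z \<noteq> d + a \<or> z \<noteq> b + d" for z
  proof -
    have "z < d + a \<or> d + a < z \<or> z < b + d \<or> b + d < z"
      using that by auto
    then show ?thesis by (elim disjE) (simp_all add: rfact_neg racah_term_def)
  qed
  show ?thesis
  proof (cases "a = b")
    case True
    have "racah_sum d a b 0 = (\<Sum>z\<in>{d + a}. racah_term d a b 0 z)"
      unfolding racah_sum_def
      by (rule sum.mono_neutral_right) (use assms True zero in auto)
    also have "\<dots> = (-1) powi (d + a) * ifact (d + a + 1) * rfact (d - a) * rfact a ^ 2"
      using True by (simp add: racah_term_def power2_eq_square) (simp add: rfact_def)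
    finally show ?thesis using True by simp
  next
    case False
    then have "racah_term d a b 0 z = 0" for z
      by (intro zero) linarith
    then show ?thesis using False by (simp add: racah_sum_def)
  qed
qed

lemma triple_value_0:
  assumes "0 \<le> a" "0 \<le> b" "0 \<le> d"
  shows "triple_value d a b 0 = (if a = b then ifact (d + a + 1) * rfact (d - a) * rfact a ^ 2 / of_int (2 * a + 1) else 0)"
proof (cases "a = b")
  case True
  have "ifact (2 * a + 1) = of_int (2 * a + 1) * ifact (2 * a)"
    using assms by (intro ifact_Suc) auto
  then have tri: "tri_factor a b 0 = 1 / of_int (2 * a + 1)"
    using assms True by (simp add: tri_factor_def Let_def fact_ratio_def)
  have sign: "(-1 :: complex) powi (d + (a + b + 0) div 2) = (-1) powi (d + a)"
    using True by simp
  have "(-1 :: complex) powi (d + a) * (-1) powi (d + a) = 1"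
    by (simp add: power_int_mult_distrib[symmetric])
  moreover have "p * (1 / n) * (p * F * r * q) = F * r * q / n" if "p * p = 1" for p n F r q :: complex
  proof -
    have "p * (1 / n) * (p * F * r * q) = (p * p) * (F * r * q) / n" by (simp add: ac_simps)
    with that show ?thesis by simp
  qed
  ultimately show ?thesis
    unfolding triple_value_def sign tri racah_sum_0[OF assms] if_P[OF True] by blast
qed (use racah_sum_0[of a b d] assms in \<open>simp add: triple_value_def\<close>)

text \<open>The relation at \<open>(b, c)\<close> can be solved for \<open>f b (c + 1)\<close>, so that induction on \<open>c\<close> applies. The
parity condition keeps to the half of the lattice that the relation connects.\<close>

lemma recurrence_unique:
  fixes f :: "int \<Rightarrow> int \<Rightarrow> complex" and e :: complex
  assumes rec: "\<And>b c. 0 \<le> b \<Longrightarrow> 0 \<le> c \<Longrightarrow> odd (x + b + c) \<Longrightarrow>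
      (2 * of_int c + 1) * ((of_int b + 1)^2 * f (b + 1) c + (e - of_int b ^ 2) * f (b - 1) c)
    = (2 * of_int b + 1) * ((of_int c + 1)^2 * f b (c + 1) + (e - of_int c ^ 2) * f b (c - 1))"
    and neg: "\<And>b c. b < 0 \<or> c < 0 \<Longrightarrow> f b c = 0"
    and base: "\<And>b. 0 \<le> b \<Longrightarrow> even (x + b) \<Longrightarrow> f b 0 = 0"
    and "even (x + b + c)"
  shows "f b c = 0"
proof -
  have "\<forall>b. even (x + b + int n) \<longrightarrow> f b (int n) = 0" for n
  proof (induction n rule: less_induct)
    case (less n)
    show ?case
    proof (intro allI impI)
      fix b assume b: "even (x + b + int n)"
      show "f b (int n) = 0"
      proof (cases "b < 0 \<or> n = 0")
        case True
        show ?thesis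
        proof (cases "b < 0")
          case False
          with True have "n = 0" by simp
          with b False show ?thesis using base[of b] by simp
        qed (simp add: neg)
      next
        case False
        then have "n \<noteq> 0" and "0 \<le> b" by simp_all
        then obtain m where m: "n = Suc m" using not0_implies_Suc by blast
        have IH: "f b' (int k) = 0" if "k < n" "even (x + b' + int k)" for b' k
          using less.IH that by blast
        have "f (b + 1) (int m) = 0" "f (b - 1) (int m) = 0"
          by (rule IH; use b m in auto)+
        moreover have "f b (int m - 1) = 0"
        proof (cases m)
          case (Suc k)
          have "f b (int k) = 0" by (rule IH; use b m Suc in auto)
          with Suc show ?thesis by simp
        qed (simp add: neg)
        moreover have "odd (x + b + int m)" using b m by simp
        ultimately have "(2 * of_int b + 1) * ((of_int (int m) + 1)^2 * f b (int m + 1)) = 0"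
          using rec[of b "int m"] \<open>0 \<le> b\<close> by simp
        moreover have "of_int (2 * b + 1) \<noteq> (0 :: complex)"
          using \<open>0 \<le> b\<close> by (simp only: of_int_eq_0_iff)
        moreover have "of_int (int m) + 1 \<noteq> (0 :: complex)"
          using of_nat_neq_0[of m, where 'a = complex] by (simp add: add.commute)
        ultimately show ?thesis by (simp add: m add.commute)
      qed
    qed
  qed
  note even_0 = this
  show ?thesis
  proof (cases "c < 0")
    case False
    then show ?thesis using even_0[of "nat c"] assms(4) by simp
  qed (simp add: neg)
qed

section \<open>Sums of products of three discrete Chebyshev polynomials\<close>

lemma triple_value_negative:
  assumes "b < 0 \<or> c < 0"
  shows "triple_value d a b c = 0"
proof -
  have "racah_sum d a b c = 0"
    using assms racah_sum_negative[of b d a c] racah_sum_negative[of c d a b] racah_sum_swap23[of d a b c] by auto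
  then show ?thesis by (simp add: triple_value_def)
qed

text \<open>Both sides are the sum of the product of the three functions with
\<open>(2b + 1) (2c + 1) (2l - d)\<close>, evaluated by the three-term recurrence in \<open>b\<close> and in \<open>c\<close>.\<close>

lemma triple_sum_recurrence:
  fixes a b c :: int and d :: nat
  assumes "0 \<le> b" "0 \<le> c"
  defines "T \<equiv> \<lambda>b c. \<Sum>l\<le>d. dcheb d a l * dcheb d b l * dcheb d c l"
  shows "(2 * of_int c + 1) * ((of_int b + 1)^2 * T (b + 1) c + ((of_nat d + 1)^2 - of_int b ^ 2) * T (b - 1) c)
    = (2 * of_int b + 1) * ((of_int c + 1)^2 * T b (c + 1) + ((of_nat d + 1)^2 - of_int c ^ 2) * T b (c - 1))"
proof -
  have "(2 * of_int c + 1) * ((of_int b + 1)^2 * T (b + 1) c + ((of_nat d + 1)^2 - of_int b ^ 2) * T (b - 1) c)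
    = (\<Sum>l\<le>d. (2 * of_int c + 1) * ((of_int b + 1)^2 * dcheb d (b + 1) l
         + ((of_nat d + 1)^2 - of_int b ^ 2) * dcheb d (b - 1) l) * dcheb d a l * dcheb d c l)"
    by (simp add: T_def sum_distrib_left sum.distrib[symmetric] algebra_simps)
  also have "\<dots> = (\<Sum>l\<le>d. (2 * of_int b + 1) * ((of_int c + 1)^2 * dcheb d (c + 1) l
         + ((of_nat d + 1)^2 - of_int c ^ 2) * dcheb d (c - 1) l) * dcheb d a l * dcheb d b l)"
    by (rule sum.cong) (simp_all add: dcheb_recurrence assms(1,2))
  also have "\<dots> = (2 * of_int b + 1) * ((of_int c + 1)^2 * T b (c + 1) + ((of_nat d + 1)^2 - of_int c ^ 2) * T b (c - 1))"
    by (simp add: T_def sum_distrib_left sum.distrib[symmetric] algebra_simps)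
  finally show ?thesis .
qed

lemma triple_sum_step:
  assumes base: "\<And>b. 0 \<le> b \<Longrightarrow> even (a + b) \<Longrightarrow>
      (\<Sum>l\<le>d. dcheb d a l * dcheb d b l * dcheb d 0 l) = triple_value (int d) a b 0"
    and "0 \<le> a" "even (a + b + c)"
  shows "(\<Sum>l\<le>d. dcheb d a l * dcheb d b l * dcheb d c l) = triple_value (int d) a b c"
proof -
  define f where "f b c = (\<Sum>l\<le>d. dcheb d a l * dcheb d b l * dcheb d c l) - triple_value (int d) a b c" for b c
  have "f b c = 0"
  proof (rule recurrence_unique[where e = "(of_nat d + 1)^2" and x = a])
    fix b c :: int assume bc: "0 \<le> b" "0 \<le> c" "odd (a + b + c)"
    show "(2 * of_int c + 1) * ((of_int b + 1)^2 * f (b + 1) c + ((of_nat d + 1)^2 - of_int b ^ 2) * f (b - 1) c)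
      = (2 * of_int b + 1) * ((of_int c + 1)^2 * f b (c + 1) + ((of_nat d + 1)^2 - of_int c ^ 2) * f b (c - 1))"
      using triple_sum_recurrence[OF bc(1,2), of d a] triple_value_recurrence[OF assms(2) bc(1,2) _ bc(3), of "int d"]
      unfolding f_def by (simp add: right_diff_distrib)  (simp add: algebra_simps)
  qed (use assms base in \<open>auto simp: f_def dcheb_neg triple_value_negative\<close>)
  then show ?thesis by (simp add: f_def)
qed

text \<open>Two applications of \<open>triple_sum_step\<close>: first for the triples \<open>(0, a, b)\<close>, starting from
\<open>(0, b, 0)\<close>, and then for \<open>(a, b, c)\<close>, starting from \<open>(a, b, 0)\<close>.\<close>

lemma triple_sum:
  assumes "0 \<le> a" "0 \<le> b" "even (a + b + c)"
  shows "(\<Sum>l\<le>d. dcheb d a l * dcheb d b l * dcheb d c l) = triple_value (int d) a b c"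
proof (rule triple_sum_step)
  fix b' :: int assume b': "0 \<le> b'" "even (a + b')"
  have base: "(\<Sum>l\<le>d. dcheb d 0 l * dcheb d b l * dcheb d 0 l) = triple_value (int d) 0 b 0" if "0 \<le> b" for b
  proof -
    have "nat (int d + 1) = Suc d" by simp
    then show ?thesis
      using dcheb_sum[OF that, of d] triple_value_0[of 0 b "int d"] that by (simp add: dcheb_0 rfact_def)
  qed
  have "(\<Sum>l\<le>d. dcheb d 0 l * dcheb d a l * dcheb d b' l) = triple_value (int d) 0 a b'"
    by (rule triple_sum_step) (use base b' in auto)
  then show "(\<Sum>l\<le>d. dcheb d a l * dcheb d b' l * dcheb d 0 l) = triple_value (int d) a b' 0"
    by (simp only: triple_value_swap12[of _ 0 a] triple_value_swap23[of _ a 0]) (simp add: dcheb_0)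
qed (use assms in auto)

section \<open>Orthogonality and completeness\<close>

definition dcheb_norm :: "nat \<Rightarrow> int \<Rightarrow> complex" where
  "dcheb_norm d a = ifact (int d + a + 1) * rfact (int d - a) * rfact a ^ 2 / of_int (2 * a + 1)"

lemma dcheb_norm_nz: "0 \<le> a \<Longrightarrow> a \<le> int d \<Longrightarrow> dcheb_norm d a \<noteq> 0"
proof -
  assume "0 \<le> a" "a \<le> int d"
  moreover from this have "of_int (2 * a + 1) \<noteq> (0 :: complex)" by (simp only: of_int_eq_0_iff)
  ultimately show ?thesis unfolding dcheb_norm_def rfact_def by (simp del: of_int_add of_int_mult)
qed

lemma sum_reflect: "(\<Sum>l\<le>d. f (d - l)) = (\<Sum>l\<le>(d::nat). f l :: complex)"
  by (rule sum.reindex_bij_witness[of _ "\<lambda>l. d - l" "\<lambda>l. d - l"]) auto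

text \<open>The summand changes its sign under \<open>l \<mapsto> d - l\<close>.\<close>

lemma odd_triple_sum:
  assumes "odd (a + b + c)"
  shows "(\<Sum>l\<le>d. dcheb d a l * dcheb d b l * dcheb d c l) = 0"
proof -
  have "(\<Sum>l\<le>d. dcheb d a l * dcheb d b l * dcheb d c l) = (\<Sum>l\<le>d. dcheb d a (d - l) * dcheb d b (d - l) * dcheb d c (d - l))"
    by (rule sum_reflect[symmetric])
  also have "\<dots> = (\<Sum>l\<le>d. - (dcheb d a l * dcheb d b l * dcheb d c l))"
    by (rule sum.cong) (use assms in \<open>auto simp: dcheb_reflect\<close>)
  finally show ?thesis by (simp add: sum_negf)
qed

text \<open>As \<open>dcheb d 0\<close> is constantly 1, this is the case \<open>c = 0\<close> of the triple sums, where the Racah sum has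
at most one term.\<close>

lemma dcheb_orthogonal:
  assumes "0 \<le> a" "0 \<le> b"
  shows "(\<Sum>l\<le>d. dcheb d a l * dcheb d b l) = (if a = b then dcheb_norm d a else 0)"
proof -
  have "(\<Sum>l\<le>d. dcheb d a l * dcheb d b l) = (\<Sum>l\<le>d. dcheb d a l * dcheb d b l * dcheb d 0 l)"
    by (simp add: dcheb_0)
  also have "\<dots> = (if a = b then dcheb_norm d a else 0)"
  proof (cases "even (a + b)")
    case True
    then show ?thesis using triple_sum[of a b 0 d] triple_value_0[of a b "int d"] assms
      by (simp add: dcheb_norm_def)
  next
    case False
    then show ?thesis using odd_triple_sum[of a b 0 d] by auto
  qed
  finally show ?thesis .
qed

text \<open>Orthogonality says that a square matrix has a left inverse; the left inverse is also a right
inverse.\<close>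

lemma dcheb_complete:
  assumes "l \<le> d" "l' \<le> d"
  shows "(\<Sum>a\<le>d. dcheb d (int a) l * (dcheb d (int a) l' / dcheb_norm d (int a))) = (if l = l' then 1 else 0)"
proof -
  define A where "A = mat (Suc d) (Suc d) (\<lambda>(a, l). dcheb d (int a) l / dcheb_norm d (int a))"
  define B where "B = mat (Suc d) (Suc d) (\<lambda>(l, a). dcheb d (int a) l)"
  have carrier: "A \<in> carrier_mat (Suc d) (Suc d)" "B \<in> carrier_mat (Suc d) (Suc d)"
    by (simp_all add: A_def B_def)
  have "A * B = 1\<^sub>m (Suc d)"
  proof (rule eq_matI)
    fix a b assume ab: "a < dim_row (1\<^sub>m (Suc d) :: complex mat)" "b < dim_col (1\<^sub>m (Suc d) :: complex mat)"
    then have "(A * B) $$ (a, b) = (\<Sum>l\<in>{0..<Suc d}. dcheb d (int a) l / dcheb_norm d (int a) * dcheb d (int b) l)"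
      by (simp add: A_def B_def scalar_prod_def)
    also have "\<dots> = (\<Sum>l\<le>d. dcheb d (int a) l * dcheb d (int b) l) / dcheb_norm d (int a)"
      unfolding atLeast0LessThan lessThan_Suc_atMost by (simp add: sum_divide_distrib)
    also have "\<dots> = (if a = b then 1 else 0)"
      using dcheb_norm_nz[of "int a" d] ab by (auto simp: dcheb_orthogonal)
    finally show "(A * B) $$ (a, b) = 1\<^sub>m (Suc d) $$ (a, b)" using ab by simp
  qed (simp_all add: A_def B_def)
  with carrier have "B * A = 1\<^sub>m (Suc d)"
    by (rule mat_mult_left_right_inverse)
  then have "(B * A) $$ (l, l') = (if l = l' then 1 else 0)"
    using assms by simp
  moreover have "(B * A) $$ (l, l') = (\<Sum>a\<in>{0..<Suc d}. dcheb d (int a) l * (dcheb d (int a) l' / dcheb_norm d (int a)))"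
    using assms by (simp add: A_def B_def scalar_prod_def)
  ultimately show ?thesis unfolding atLeast0LessThan lessThan_Suc_atMost by simp
qed

lemma dcheb_expansion:
  assumes "l \<le> d"
  shows "f l = (\<Sum>a\<le>d. (\<Sum>l'\<le>d. f l' * dcheb d (int a) l') / dcheb_norm d (int a) * dcheb d (int a) l)"
proof -
  have "(\<Sum>a\<le>d. (\<Sum>l'\<le>d. f l' * dcheb d (int a) l') / dcheb_norm d (int a) * dcheb d (int a) l)
     = (\<Sum>a\<le>d. \<Sum>l'\<le>d. f l' * (dcheb d (int a) l * (dcheb d (int a) l' / dcheb_norm d (int a))))"
    by (rule sum.cong[OF refl]) (simp add: sum_divide_distrib sum_distrib_left sum_distrib_right mult_ac)
  also have "\<dots> = (\<Sum>l'\<le>d. f l' * (\<Sum>a\<le>d. dcheb d (int a) l * (dcheb d (int a) l' / dcheb_norm d (int a))))"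
    by (subst sum.swap) (simp add: sum_distrib_left)
  also have "\<dots> = (\<Sum>l'\<le>d. if l' = l then f l' else 0)"
    by (rule sum.cong[OF refl], subst dcheb_complete) (use assms in auto)
  also have "\<dots> = f l"
    using assms by simp
  finally show ?thesis by simp
qed

section \<open>The coefficients omega as Racah sums\<close>

lemma minus_one_powi_add_even: "(-1 :: complex) powi (k + 2 * m) = (-1) powi k"
proof -
  have "(-1 :: complex) powi (2 * m) = ((-1) powi 2) powi m"
    by (rule power_int_mult)
  then show ?thesis by (simp add: power_int_add)
qed

text \<open>For these parameters the seven factorial arguments in the third factor become those of
\<open>racah_term\<close>, and the quotients $(2m)!/m!$ in the second factor combine to \<open>tri_factor\<close>.\<close>

lemma omega_eq:
  fixes a b d t g :: int
  assumes g: "a + b + t = 2 * g" and "0 \<le> t" "t \<le> a + b" "a \<le> b + t" "b \<le> a + t" "0 \<le> d"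
  shows "omega d a b b a t = ifact a ^ 3 * ifact b ^ 3 * ifact (d - a) * ifact (d - b) / (ifact (2 * a) * ifact (2 * b) * ifact d)
     * (ifact (2 * t + 1) / (ifact t * ifact (d + t + 1))) * triple_value d a b t"
proof -
  have P1: "omega_P1 d a b b a = ifact a ^ 3 * ifact b ^ 3 * ifact (d - a) * ifact (d - b) / (ifact (2 * a) * ifact (2 * b) * ifact d)"
  proof -
    have "2 * b - b = b" "2 * a - a = a" "2 * b + d - 2 * b - a = d - a" "2 * b + d - 2 * b = d" by simp_all
    then show ?thesis unfolding omega_P1_def by (simp only:) (simp add: power3_eq_cube mult_ac)
  qed
  have P2: "omega_P2 d a b b a t = tri_factor a b t * (ifact (2 * t + 1) / (ifact t * ifact (d + t + 1)))"
  proof -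
    have half: "(a + b + t) div 2 = g" "(a + b - t) div 2 = g - t" "(a - b + t) div 2 = g - b" "(b - a + t) div 2 = g - a"
      using g by presburger+
    have double: "a + b - t = 2 * (g - t)" "a - b + t = 2 * (g - b)" "b - a + t = 2 * (g - a)"
      "a + b + t + 1 = 2 * g + 1" "a + b + d - b - a + t + 1 = d + t + 1"
      using g by presburger+
    have nonneg: "0 \<le> g - t" "0 \<le> g - b" "0 \<le> g - a"
      using g assms by presburger+
    show ?thesis
      unfolding omega_P2_def half unfolding double tri_factor_def Let_def half fact_ratio_def
      using nonneg by (simp add: mult_ac)
  qed
  have P3: "omega_P3 d a b b a t = racah_sum d a b t"
  proof -
    have idx: "z - 2 * b - d + b = z - b - d" "z - 2 * a - 2 * b - d + 2 * b + a = z - a - d"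
      "z - a - b - d + b + a - t = z - t - d" "a + b + d - b + t - z = d + a + t - z"
      "2 * a + 2 * b + d - b - a - z = d + a + b - z" "a + 3 * b + d - 2 * b - a + t - z = d + b + t - z" for z
      by simp_all
    have sub: "omega_P3_indices d a b b a t \<subseteq> {0..d + a + b + t}"
      using assms g unfolding omega_P3_indices_def by auto
    have "omega_P3 d a b b a t = (\<Sum>z\<in>omega_P3_indices d a b b a t. racah_term d a b t z)"
      unfolding omega_P3_def
    proof (rule sum.cong[OF refl])
      fix z assume "z \<in> omega_P3_indices d a b b a t"
      then have "0 \<le> z - a - b - t" "0 \<le> z - b - d" "0 \<le> z - a - d" "0 \<le> z - t - d"
        "0 \<le> d + a + t - z" "0 \<le> d + a + b - z" "0 \<le> d + b + t - z"
        unfolding omega_P3_indices_def idx by simp_all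
      then show "(- 1) powi z * ifact (z + 1) *
         inverse (ifact (z - a - b - t) * ifact (z - 2 * b - d + b) * ifact (z - 2 * a - 2 * b - d + 2 * b + a) *
           ifact (z - a - b - d + b + a - t) * ifact (a + b + d - b + t - z) * ifact (2 * a + 2 * b + d - b - a - z) *
           ifact (a + 3 * b + d - 2 * b - a + t - z)) = racah_term d a b t z"
        unfolding idx racah_term_def rfact_def by (simp add: divide_simps mult_ac)
    qed
    also have "\<dots> = (\<Sum>z\<in>{0..d + a + b + t}. racah_term d a b t z)"
    proof (rule sum.mono_neutral_left[OF _ sub])
      have "0 \<le> k" if "rfact k \<noteq> 0" for k
        using that rfact_neg by (metis not_le)
      then show "\<forall>z\<in>{0..d + a + b + t} - omega_P3_indices d a b b a t. racah_term d a b t z = 0"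
        unfolding omega_P3_indices_def idx racah_term_def by force
    qed simp
    finally show ?thesis by (simp only: racah_sum_def)
  qed
  have sgn: "(-1 :: complex) powi (d + b + a + (a + b - t) div 2) = (-1) powi (d + (a + b + t) div 2)"
  proof -
    have "(a + b - t) div 2 = g - t" "(a + b + t) div 2 = g"
      using g by presburger+
    then have "d + b + a + (a + b - t) div 2 = d + (a + b + t) div 2 + 2 * (g - t)"
      using g by simp
    then show ?thesis by (simp only: minus_one_powi_add_even)
  qed
  show ?thesis
    unfolding omega_def triple_value_def P1 P2 P3 sgn by (simp only: mult_ac)
qed

lemma racah_sum_triangle:
  assumes "0 \<le> a" "0 \<le> b" "0 \<le> c" "0 \<le> d" "a + b < c \<or> a + c < b \<or> b + c < a"
  shows "racah_sum d a b c = 0"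
  using assms racah_sum_large[of a b c d] racah_sum_large[of a c b d] racah_sum_large[of c b a d]
    racah_sum_swap23[of d a b c] racah_sum_swap12[of d c b a] racah_sum_swap23[of d b c a] racah_sum_swap12[of d a b c]
  by auto

section \<open>The eigenvalues and their product formula\<close>

text \<open>The normalisation for which the product of two eigenvalues expands with the coefficients
\<open>omega\<close> themselves, without further factors.\<close>

definition eigval_scale :: "nat \<Rightarrow> nat \<Rightarrow> complex" where
  "eigval_scale d a = fact a ^ 3 * fact (d - a) / (fact (2 * a) * fact d)"

lemma eigval_scale_nz: "eigval_scale d a \<noteq> 0"
  by (simp add: eigval_scale_def)

definition eigval :: "nat \<Rightarrow> nat \<Rightarrow> nat \<Rightarrow> complex" where
  "eigval d a l = eigval_scale d a * dcheb d (int a) l"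

lemma eigval_scale_norm:
  assumes "a \<le> d"
  shows "eigval_scale d a * dcheb_norm d (int a) = fact a * fact (d + a + 1) / (fact (2 * a + 1) * fact d)"
proof -
  have n: "nat (int d + int a + 1) = d + a + 1" "nat (int d - int a) = d - a" using assms by auto
  have f: "fact (2 * a + 1) = of_int (2 * int a + 1) * (fact (2 * a) :: complex)" by simp
  show ?thesis
    using assms unfolding eigval_scale_def dcheb_norm_def rfact_def n f by (simp add: power2_eq_square power3_eq_cube)
qed

text \<open>Outside the range of \<open>alpha\<close> the triangle inequality fails, and both sides vanish.\<close>

lemma alpha_eq:
  assumes "i \<le> d div 2" "j \<le> d div 2" "k \<le> d div 2"
  shows "alpha d (int (2 * k)) i j * (eigval_scale d (2 * k) * dcheb_norm d (int (2 * k)))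
    = eigval_scale d (d - 2 * i) * eigval_scale d (d - 2 * j) * triple_value (int d) (int (d - 2 * i)) (int (d - 2 * j)) (int (2 * k))"
proof -
  define A B where "A = d - 2 * i" and "B = d - 2 * j"
  have A: "int d - 2 * int i = int A" and B: "int d - 2 * int j = int B"
    and le: "A \<le> d" "B \<le> d" "2 * k \<le> d"
    using assms by (auto simp: A_def B_def)
  show ?thesis
  proof (cases "alpha_range d i j (int (2 * k))")
    case True
    have "omega (int d) (int B) (int A) (int A) (int B) (int (2 * k)) = ifact (int B) ^ 3 * ifact (int A) ^ 3 * ifact (int d - int B) * ifact (int d - int A)
        / (ifact (2 * int B) * ifact (2 * int A) * ifact (int d))
     * (ifact (2 * int (2 * k) + 1) / (ifact (int (2 * k)) * ifact (int d + int (2 * k) + 1))) * triple_value (int d) (int B) (int A) (int (2 * k))"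
      by (rule omega_eq[where g = "int d - int i - int j + int k"])
         (use True in \<open>auto simp: alpha_range_def A[symmetric] B[symmetric]\<close>)
    moreover have "nat (int d - int A) = d - A" "nat (int d - int B) = d - B" "nat (2 * int A) = 2 * A" "nat (2 * int B) = 2 * B"
      "nat (2 * int (2 * k) + 1) = 2 * (2 * k) + 1" "nat (int d + int (2 * k) + 1) = d + 2 * k + 1" "nat (int (2 * k)) = 2 * k"
      by auto
    ultimately have "alpha d (int (2 * k)) i j = fact B ^ 3 * fact A ^ 3 * fact (d - B) * fact (d - A)
        / (fact (2 * B) * fact (2 * A) * fact d)
     * (fact (2 * (2 * k) + 1) / (fact (2 * k) * fact (d + 2 * k + 1))) * triple_value (int d) (int A) (int B) (int (2 * k))"
      using True unfolding alpha_def A B by (simp only: if_True nat_int triple_value_swap12[of _ "int B"])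
    moreover have "x * (f / (h * u)) * v * (h * u / (f * e)) = x / e * v"
      if "f \<noteq> 0" "h \<noteq> 0" "u \<noteq> 0" for x f h u v e :: complex
      using that by simp
    ultimately show ?thesis
      unfolding eigval_scale_norm[OF le(3)] unfolding A_def[symmetric] B_def[symmetric]
      by (simp only: fact_nonzero not_False_eq_True) (simp add: eigval_scale_def mult_ac)
  next
    case False
    then have "int A + int B < int (2 * k) \<or> int A + int (2 * k) < int B \<or> int B + int (2 * k) < int A"
      using le unfolding A[symmetric] B[symmetric] alpha_range_def by (auto split: if_splits)
    then have "racah_sum (int d) (int A) (int B) (int (2 * k)) = 0"
      by (intro racah_sum_triangle) auto
    with False show ?thesis unfolding A_def[symmetric] B_def[symmetric]
      by (simp add: alpha_def triple_value_def)
  qed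
qed

text \<open>The expansion of the product of two discrete Chebyshev polynomials in the orthogonal
basis has the coefficients \<open>triple_sum\<close> divided by norms. Odd indices drop out by parity.\<close>

lemma eigval_product:
  assumes "i \<le> d div 2" "j \<le> d div 2" "l \<le> d"
  shows "eigval d (d - 2 * i) l * eigval d (d - 2 * j) l = (\<Sum>k\<le>d div 2. alpha d (int (2 * k)) i j * eigval d (2 * k) l)"
proof -
  define A B where "A = d - 2 * i" and "B = d - 2 * j"
  have "even (2 * d)" by simp
  then have AB: "even (int A + int B)"
    using assms by (auto simp: A_def B_def of_nat_diff)
  define F where "F = (\<lambda>c. \<Sum>l'\<le>d. dcheb d (int A) l' * dcheb d (int B) l' * dcheb d c l')"
  have odd: "F c = 0" if "odd c" for c
    unfolding F_def by (rule odd_triple_sum) (use that AB in auto)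
  have even: "F c = triple_value (int d) (int A) (int B) c" if "even c" for c
    unfolding F_def by (rule triple_sum) (use that AB in auto)
  have "dcheb d (int A) l * dcheb d (int B) l = (\<Sum>c\<le>d. F (int c) / dcheb_norm d (int c) * dcheb d (int c) l)"
    unfolding F_def by (rule dcheb_expansion[OF assms(3)])
  also have "\<dots> = (\<Sum>c\<in>(\<lambda>k. 2 * k) ` {..d div 2}. F (int c) / dcheb_norm d (int c) * dcheb d (int c) l)"
  proof (rule sum.mono_neutral_right)
    show "\<forall>c\<in>{..d} - (\<lambda>k. 2 * k) ` {..d div 2}. F (int c) / dcheb_norm d (int c) * dcheb d (int c) l = 0"
    proof
      fix c assume c: "c \<in> {..d} - (\<lambda>k. 2 * k) ` {..d div 2}"
      have "odd c"
      proof
        assume "even c"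
        then have "c = 2 * (c div 2)" by simp
        moreover have "c div 2 \<le> d div 2" using c by (simp add: div_le_mono)
        ultimately show False using c by blast
      qed
      then show "F (int c) / dcheb_norm d (int c) * dcheb d (int c) l = 0" by (simp add: odd)
    qed
  qed auto
  also have "\<dots> = (\<Sum>k\<le>d div 2. F (int (2 * k)) / dcheb_norm d (int (2 * k)) * dcheb d (int (2 * k)) l)"
    by (subst sum.reindex) (simp_all add: inj_on_def)
  finally have product: "dcheb d (int A) l * dcheb d (int B) l
      = (\<Sum>k\<le>d div 2. F (int (2 * k)) / dcheb_norm d (int (2 * k)) * dcheb d (int (2 * k)) l)" .
  have "eigval d A l * eigval d B l = eigval_scale d A * eigval_scale d B * (dcheb d (int A) l * dcheb d (int B) l)"
    by (simp add: eigval_def)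
  also have "\<dots> = (\<Sum>k\<le>d div 2. eigval_scale d A * eigval_scale d B * (F (int (2 * k)) / dcheb_norm d (int (2 * k)) * dcheb d (int (2 * k)) l))"
    unfolding product by (rule sum_distrib_left)
  also have "\<dots> = (\<Sum>k\<le>d div 2. alpha d (int (2 * k)) i j * eigval d (2 * k) l)"
  proof (rule sum.cong[OF refl])
    fix k assume "k \<in> {..d div 2}"
    then have k: "k \<le> d div 2" by simp
    have nz: "dcheb_norm d (int (2 * k)) \<noteq> 0" by (rule dcheb_norm_nz) (use k in auto)
    have "alpha d (int (2 * k)) i j * (eigval_scale d (2 * k) * dcheb_norm d (int (2 * k))) = eigval_scale d A * eigval_scale d B * F (int (2 * k))"
      using alpha_eq[OF assms(1,2) k] by (simp add: even A_def B_def)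
    moreover have "x * (f / h * t) = y * (s * t)" if "y * (s * h) = x * f" "h \<noteq> 0" for x f h t y s :: complex
      using that by (simp add: field_simps)
    ultimately show "eigval_scale d A * eigval_scale d B * (F (int (2 * k)) / dcheb_norm d (int (2 * k)) * dcheb d (int (2 * k)) l)
      = alpha d (int (2 * k)) i j * eigval d (2 * k) l"
      unfolding eigval_def using nz by blast
  qed
  finally show ?thesis by (simp only: A_def B_def)
qed

section \<open>The sequence of a sign sequence as an inverse transform\<close>

text \<open>The inner sum over $p$ and $q$ in \<open>E\<^sub>2\<close>.\<close>

lemma krawtchouk_factorial_sum:
  "(\<Sum>(p, q)\<in>{(p, q). p \<le> l \<and> q \<le> m \<and> p + q = N}. (-1) ^ q / (fact p * fact q * fact (l - p) * fact (m - q)))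
    = krawtchouk l m N / (fact l * fact m)"
proof -
  have "(\<Sum>(p, q)\<in>{(p, q). p \<le> l \<and> q \<le> m \<and> p + q = N}. (-1) ^ q / (fact p * fact q * fact (l - p) * fact (m - q)))
     = (\<Sum>p\<in>{p. p \<le> l \<and> p \<le> N \<and> N - p \<le> m}. (-1) ^ (N - p) / (fact p * fact (N - p) * fact (l - p) * fact (m - (N - p))) :: complex)"
    by (rule sum.reindex_bij_witness[of _ "\<lambda>p. (p, N - p)" fst]) auto
  also have "\<dots> = (\<Sum>p\<in>{p. p \<le> l \<and> p \<le> N \<and> N - p \<le> m}. of_nat (l choose p) * ((-1) ^ (N - p) * of_nat (m choose (N - p))) / (fact l * fact m))"
    by (rule sum.cong) (auto simp: binomial_fact)
  also have "\<dots> = (\<Sum>p\<le>N. of_nat (l choose p) * ((-1) ^ (N - p) * of_nat (m choose (N - p))) / (fact l * fact m))"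
    by (rule sum.mono_neutral_left) (auto simp: not_le)
  finally show ?thesis by (simp add: krawtchouk_eq_sum sum_divide_distrib)
qed

text \<open>The sum over $e$ in \<open>E\<^sub>2\<close> is a sum over all moments, since the moments with \<open>N < d - 2i\<close> or of the
wrong parity vanish.\<close>

lemma legendre_moment_sum:
  assumes "i \<le> d div 2" and l: "l \<le> d"
  shows "(\<Sum>e\<le>i. fact (d - 2 * e) * fact (d - i - e) / (fact (2 * d - 2 * i - 2 * e + 1) * fact (i - e)) * krawtchouk l (d - l) (d - 2 * e))
    = (\<Sum>N\<le>d. legendre_moment (int (d - 2 * i)) (int N) * krawtchouk l (d - l) N)"
proof -
  have "(\<Sum>N\<le>d. legendre_moment (int (d - 2 * i)) (int N) * krawtchouk l (d - l) N)
    = (\<Sum>N\<in>(\<lambda>e. d - 2 * e) ` {..i}. legendre_moment (int (d - 2 * i)) (int N) * krawtchouk l (d - l) N)"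
  proof (rule sum.mono_neutral_right)
    show "\<forall>N\<in>{..d} - (\<lambda>e. d - 2 * e) ` {..i}. legendre_moment (int (d - 2 * i)) (int N) * krawtchouk l (d - l) N = 0"
    proof
      fix N assume N: "N \<in> {..d} - (\<lambda>e. d - 2 * e) ` {..i}"
      show "legendre_moment (int (d - 2 * i)) (int N) * krawtchouk l (d - l) N = 0"
      proof (cases "even (int N + int (d - 2 * i))")
        case True
        have "even (d - N)"
          using True N assms by (auto simp: of_nat_diff)
        then obtain e where "d - N = 2 * e" by (elim evenE)
        with N have e: "N = d - 2 * e" "2 * e \<le> d" by auto
        with N have "\<not> e \<le> i" by blast
        then have "(int N - int (d - 2 * i)) div 2 < 0" using e assms by auto
        then have zero: "rfact ((int N - int (d - 2 * i)) div 2) = 0" by (rule rfact_neg)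
        show ?thesis unfolding legendre_moment_def zero by (simp only: mult_zero_left mult_zero_right if_cancel)
      next
        case False
        then show ?thesis by (simp only: legendre_moment_def if_False mult_zero_left)
      qed
    qed
  qed auto
  also have "\<dots> = (\<Sum>e\<le>i. legendre_moment (int (d - 2 * i)) (int (d - 2 * e)) * krawtchouk l (d - l) (d - 2 * e))"
    by (subst sum.reindex) (use assms in \<open>auto simp: inj_on_def\<close>)
  also have "\<dots> = (\<Sum>e\<le>i. fact (d - 2 * e) * fact (d - i - e) / (fact (2 * d - 2 * i - 2 * e + 1) * fact (i - e)) * krawtchouk l (d - l) (d - 2 * e))"
  proof (rule sum.cong[OF refl])
    fix e assume "e \<in> {..i}"
    then have e: "e \<le> i" by simp
    have "int (d - 2 * e) + int (d - 2 * i) = 2 * int (d - i - e)"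
      "int (d - 2 * e) - int (d - 2 * i) = 2 * int (i - e)"
      using e assms by auto
    moreover have "nat (2 * int (d - i - e) + 1) = 2 * d - 2 * i - 2 * e + 1" using e assms by auto
    ultimately have "legendre_moment (int (d - 2 * i)) (int (d - 2 * e)) = fact (d - 2 * e) * fact (d - i - e) / (fact (2 * d - 2 * i - 2 * e + 1) * fact (i - e))"
      unfolding legendre_moment_def rfact_def by (simp del: fact_Suc)
    then show "legendre_moment (int (d - 2 * i)) (int (d - 2 * e)) * krawtchouk l (d - l) (d - 2 * e)
      = fact (d - 2 * e) * fact (d - i - e) / (fact (2 * d - 2 * i - 2 * e + 1) * fact (i - e)) * krawtchouk l (d - l) (d - 2 * e)"
      by simp
  qed
  finally show ?thesis by simp
qed

text \<open>The weight \<open>m\<^sub>l\<close> halves the middle term, which is its own mirror image.\<close>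

lemma m_weight_sum:
  fixes g :: "nat \<Rightarrow> complex"
  assumes "\<And>l. l \<le> d \<Longrightarrow> g (d - l) = g l"
  shows "(\<Sum>l\<le>d div 2. m_weight d l * g l) = (\<Sum>l\<le>d. g l) / 2"
proof -
  have "(\<Sum>l\<le>d. g l) = (\<Sum>l\<le>d div 2. g l) + (\<Sum>l\<in>{d div 2<..d}. g l)"
    by (subst sum.union_disjoint[symmetric]) (auto intro: arg_cong[where f = "sum g"])
  also have "(\<Sum>l\<in>{d div 2<..d}. g l) = (\<Sum>l\<in>{l. l < d - d div 2}. g l)"
    by (rule sum.reindex_bij_witness[of _ "\<lambda>l. d - l" "\<lambda>l. d - l"]) (auto simp: assms)
  also have "{l. l < d - d div 2} = {l. l \<le> d div 2 \<and> 2 * l \<noteq> d}"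
    by auto
  also have "(\<Sum>l | l \<le> d div 2 \<and> 2 * l \<noteq> d. g l) = (\<Sum>l\<le>d div 2. if 2 * l \<noteq> d then g l else 0)"
    by (rule sum.mono_neutral_cong_left) auto
  also have "(\<Sum>l\<le>d div 2. g l) + (\<Sum>l\<le>d div 2. if 2 * l \<noteq> d then g l else 0) = (\<Sum>l\<le>d div 2. 2 * (m_weight d l * g l))"
    unfolding sum.distrib[symmetric] by (rule sum.cong) (auto simp: m_weight_def)
  also have "\<dots> = 2 * (\<Sum>l\<le>d div 2. m_weight d l * g l)"
    by (simp add: sum_distrib_left)
  finally show ?thesis by simp
qed

text \<open>The sums over $e$, $p$, $q$ add up to the Legendre pairing that defines \<open>dcheb\<close>, and by the symmetry of
$s$ the weighted sum over half of the points is a sum over all of them.\<close>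

lemma E2_eq:
  assumes s: "s \<in> sign_sequences d" and i: "i \<le> d div 2"
  defines "a \<equiv> d - 2 * i"
  shows "E2 d s i = 2 ^ (2 * i) * fact a / (2 * fact (d + a + 1)) * (\<Sum>l\<le>d. of_int (s l) * dcheb d (int a) l)"
proof -
  have "2 * i \<le> d" using i by simp
  define c where "c = (\<lambda>e. fact (d - 2 * e) * fact (d - i - e) / (fact (2 * d - 2 * i - 2 * e + 1) * fact (i - e)) :: complex)"
  define r where "r = (\<lambda>l p q. (-1) ^ q / (fact p * fact q * fact (l - p) * fact (d - l - q)) :: complex)"
  define PQ where "PQ = (\<lambda>e l. {(p, q). p \<le> l \<and> q \<le> d - l \<and> p + q = d - 2 * e})"
  define g where "g = (\<lambda>l. of_int (s l) * (\<Sum>N\<le>d. legendre_moment (int a) (int N) * krawtchouk l (d - l) N) / (fact l * fact (d - l)))"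
  have fin: "finite (PQ e l)" for e l
    by (rule finite_subset[of _ "{..l} \<times> {..d}"]) (auto simp: PQ_def)
  have idx: "E2_indices d i = (SIGMA e:{..i}. SIGMA l:{..d div 2}. PQ e l)"
    by (auto simp: E2_indices_def PQ_def)
  have "E2 d s i = (\<Sum>(e, l, p, q)\<in>E2_indices d i. of_int (s l) * m_weight d l * (c e * r l p q))"
    unfolding E2_def c_def r_def
    by (rule sum.cong[OF refl]) (simp add: case_prod_unfold mult_ac del: fact_Suc)
  also have "\<dots> = (\<Sum>e\<le>i. \<Sum>(l, p, q)\<in>(SIGMA l:{..d div 2}. PQ e l). of_int (s l) * m_weight d l * (c e * r l p q))"
    unfolding idx by (rule sum.Sigma[symmetric]) (auto simp: fin)
  also have "\<dots> = (\<Sum>e\<le>i. \<Sum>l\<le>d div 2. \<Sum>(p, q)\<in>PQ e l. of_int (s l) * m_weight d l * (c e * r l p q))"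
    by (rule sum.cong[OF refl], rule sum.Sigma[symmetric]) (auto simp: fin)
  also have "\<dots> = (\<Sum>e\<le>i. \<Sum>l\<le>d div 2. of_int (s l) * m_weight d l * (c e * (krawtchouk l (d - l) (d - 2 * e) / (fact l * fact (d - l)))))"
    unfolding krawtchouk_factorial_sum[symmetric] PQ_def r_def
    by (simp add: sum_distrib_left case_prod_unfold)
  also have "\<dots> = (\<Sum>l\<le>d div 2. m_weight d l * (of_int (s l) * (\<Sum>e\<le>i. c e * krawtchouk l (d - l) (d - 2 * e)) / (fact l * fact (d - l))))"
    by (subst sum.swap) (simp add: sum_distrib_left sum_divide_distrib mult_ac)
  also have "\<dots> = (\<Sum>l\<le>d div 2. m_weight d l * g l)"
  proof (rule sum.cong[OF refl])
    fix l assume "l \<in> {..d div 2}"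
    then have "l \<le> d" by auto
    from legendre_moment_sum[OF i this] show "m_weight d l * (of_int (s l) * (\<Sum>e\<le>i. c e * krawtchouk l (d - l) (d - 2 * e)) / (fact l * fact (d - l))) = m_weight d l * g l"
      unfolding g_def c_def a_def by simp
  qed
  also have g_eq: "g l = 2 ^ (2 * i) * fact a / fact (d + a + 1) * (of_int (s l) * dcheb d (int a) l)" if "l \<le> d" for l
  proof -
    have "int a - int d = - int (2 * i)" using i by (simp add: a_def)
    then have "dcheb d (int a) l = fact (d + a + 1) / (2 ^ (2 * i) * fact a) / (fact l * fact (d - l)) * (\<Sum>N\<le>d. legendre_moment (int a) (int N) * krawtchouk l (d - l) N)"
    proof -
      have n: "nat (int d + int a + 1) = d + a + 1" by auto
      have p: "(2 :: complex) powi - int (2 * i) = 1 / 2 ^ (2 * i)"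
        by (simp only: power_int_minus power_int_of_nat inverse_eq_divide)
      show ?thesis unfolding dcheb_def \<open>int a - int d = - int (2 * i)\<close> n p rfact_def by simp
    qed
    then show ?thesis unfolding g_def by (simp del: fact_Suc)
  qed
  have "(\<Sum>l\<le>d div 2. m_weight d l * g l) = (\<Sum>l\<le>d. g l) / 2"
  proof (rule m_weight_sum)
    fix l assume l: "l \<le> d"
    have "s (d - l) = (-1) ^ d * s l" using s l by (simp add: sign_sequences_def)
    moreover have "even a \<longleftrightarrow> even d" using \<open>2 * i \<le> d\<close> by (simp add: a_def)
    ultimately show "g (d - l) = g l"
      using l by (simp add: g_eq dcheb_reflect minus_one_power_iff)
  qed
  also have "(\<Sum>l\<le>d. g l) / 2 = 2 ^ (2 * i) * fact a / (2 * fact (d + a + 1)) * (\<Sum>l\<le>d. of_int (s l) * dcheb d (int a) l)"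
  proof -
    have "(\<Sum>l\<le>d. g l) = 2 ^ (2 * i) * fact a / fact (d + a + 1) * (\<Sum>l\<le>d. of_int (s l) * dcheb d (int a) l)"
      unfolding sum_distrib_left by (rule sum.cong[OF refl], rule g_eq) simp
    then show ?thesis by (simp del: fact_Suc)
  qed
  finally show ?thesis .
qed

text \<open>By \<open>E2_eq\<close>, \<open>E\<^sub>2\<close> is the scalar product with a discrete Chebyshev polynomial up to a factor; \<open>E\<^sub>1\<close> removes this factor and divides
by the norm.\<close>

lemma zseq_eq:
  assumes s: "s \<in> sign_sequences d" and i: "i \<le> d div 2"
  defines "a \<equiv> d - 2 * i"
  shows "zseq d s i * (eigval_scale d a * dcheb_norm d (int a)) = (\<Sum>l\<le>d. of_int (s l) * dcheb d (int a) l)"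
proof -
  have a: "a \<le> d" by (simp add: a_def)
  have "2 * d - 4 * i + 1 = 2 * a + 1" by (simp add: a_def)
  moreover have "(2::complex) powi (2 * int i - 1) = 2 ^ (2 * i) / 2"
  proof -
    have "(2::complex) powi (2 * int i - 1) = 2 powi int (2 * i) / 2 powi 1"
      by (subst power_int_diff[symmetric]) simp_all
    then show ?thesis by (simp only: power_int_of_nat power_int_1_right)
  qed
  ultimately have E1: "E1 d i = fact d * fact (2 * a + 1) / (2 ^ (2 * i) / 2 * fact a ^ 2)"
    by (simp only: E1_def a_def)
  have cancel: "D * F / (T / 2 * A ^ 2) * (T * A / (2 * H) * x) * (A * H / (F * D)) = x"
    if "D \<noteq> 0" "F \<noteq> 0" "T \<noteq> 0" "A \<noteq> 0" "H \<noteq> 0" for D F T A H x :: complex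
  proof -
    have "D * F / (T / 2 * A ^ 2) * (T * A / (2 * H) * x) * (A * H / (F * D))
      = (D * F * T * A ^ 2 * H) * x / (D * F * T * A ^ 2 * H)"
      by (simp add: power2_eq_square)
    with that show ?thesis by simp
  qed
  have z: "zseq d s i = E1 d i * E2 d s i"
    using i by (simp add: zseq_def)
  show ?thesis
    unfolding z E1 E2_eq[OF s i, folded a_def] eigval_scale_norm[OF a] by (rule cancel) (rule fact_nonzero, rule fact_nonzero, simp, (rule fact_nonzero)+)
qed

section \<open>Involutors\<close>

lemma eigval_0: "l \<le> d \<Longrightarrow> eigval d 0 l = 1"
  by (simp add: eigval_def eigval_scale_def dcheb_0)

text \<open>By orthogonality, a combination of eigenvalue functions with distinct degrees determines its coefficients.\<close>

lemma eigval_coefficient: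
  fixes h :: "nat \<Rightarrow> nat"
  assumes inj: "inj_on h {..n}" and "k \<le> n"
  shows "(\<Sum>l\<le>d. (\<Sum>i\<le>n. \<beta> i * eigval d (h i) l) * dcheb d (int (h k)) l)
    = \<beta> k * (eigval_scale d (h k) * dcheb_norm d (int (h k)))"
proof -
  have "(\<Sum>l\<le>d. (\<Sum>i\<le>n. \<beta> i * eigval d (h i) l) * dcheb d (int (h k)) l)
     = (\<Sum>i\<le>n. \<beta> i * eigval_scale d (h i) * (\<Sum>l\<le>d. dcheb d (int (h i)) l * dcheb d (int (h k)) l))"
    unfolding sum_distrib_right sum_distrib_left by (subst sum.swap) (simp add: eigval_def mult_ac)
  also have "\<dots> = (\<Sum>i\<le>n. if i = k then \<beta> k * (eigval_scale d (h k) * dcheb_norm d (int (h k))) else 0)"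
  proof (rule sum.cong[OF refl])
    fix i assume "i \<in> {..n}"
    then have "int (h i) = int (h k) \<longleftrightarrow> i = k" using inj assms(2) by (auto dest: inj_onD)
    then show "\<beta> i * eigval_scale d (h i) * (\<Sum>l\<le>d. dcheb d (int (h i)) l * dcheb d (int (h k)) l)
      = (if i = k then \<beta> k * (eigval_scale d (h k) * dcheb_norm d (int (h k))) else 0)"
      by (subst dcheb_orthogonal) auto
  qed
  also have "\<dots> = \<beta> k * (eigval_scale d (h k) * dcheb_norm d (int (h k)))"
    using assms(2) by simp
  finally show ?thesis .
qed

lemma eigval_scale_norm_nz: "a \<le> d \<Longrightarrow> eigval_scale d a * dcheb_norm d (int a) \<noteq> 0"
  by (simp add: eigval_scale_nz dcheb_norm_nz)

lemma eigval_square: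
  assumes "l \<le> d"
  shows "(\<Sum>i\<le>d div 2. z i * eigval d (d - 2 * i) l)^2
    = (\<Sum>k\<le>d div 2. (\<Sum>i\<le>d div 2. \<Sum>j\<le>d div 2. alpha d (int (2 * k)) i j * z i * z j) * eigval d (2 * k) l)"
proof -
  have "(\<Sum>i\<le>d div 2. z i * eigval d (d - 2 * i) l)^2
    = (\<Sum>i\<le>d div 2. \<Sum>j\<le>d div 2. z i * z j * (eigval d (d - 2 * i) l * eigval d (d - 2 * j) l))"
    by (simp add: power2_eq_square sum_product mult_ac)
  also have "\<dots> = (\<Sum>i\<le>d div 2. \<Sum>j\<le>d div 2. \<Sum>k\<le>d div 2. z i * z j * (alpha d (int (2 * k)) i j * eigval d (2 * k) l))"
    by (intro sum.cong refl) (simp add: eigval_product assms sum_distrib_left)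
  also have "\<dots> = (\<Sum>i\<le>d div 2. \<Sum>k\<le>d div 2. \<Sum>j\<le>d div 2. z i * z j * (alpha d (int (2 * k)) i j * eigval d (2 * k) l))"
    by (intro sum.cong refl sum.swap)
  also have "\<dots> = (\<Sum>k\<le>d div 2. \<Sum>i\<le>d div 2. \<Sum>j\<le>d div 2. z i * z j * (alpha d (int (2 * k)) i j * eigval d (2 * k) l))"
    by (rule sum.swap)
  finally show ?thesis by (simp add: sum_distrib_right sum_distrib_left mult_ac)
qed

text \<open>Squaring the eigenvalue and expanding it by \<open>eigval_square\<close> gives the coefficients $S_k$ on the
left of the system. They are determined by the function, and the constant function 1 is the one with
\<open>S\<^sub>0 = 1\<close> and all other coefficients 0.\<close>

lemma involutors_iff:
  assumes "z \<in> {..d div 2} \<rightarrow>\<^sub>E UNIV"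
  shows "z \<in> involutors d \<longleftrightarrow> (\<forall>l\<le>d. (\<Sum>i\<le>d div 2. z i * eigval d (d - 2 * i) l)^2 = 1)"
proof -
  define n where "n = d div 2"
  define S where "S k = (\<Sum>i\<le>n. \<Sum>j\<le>n. alpha d (int (2 * k)) i j * z i * z j)" for k
  have S0: "S 0 = (\<Sum>i\<le>n. alpha d 0 i i * (z i)\<^sup>2)"
  proof -
    have "S 0 = (\<Sum>i\<le>n. \<Sum>j\<in>{i}. alpha d (int (2 * 0)) i j * z i * z j)"
      unfolding S_def
      by (rule sum.cong[OF refl], rule sum.mono_neutral_right) (auto simp: alpha_def alpha_range_def)
    then show ?thesis by (simp add: power2_eq_square mult.assoc)
  qed
  have "(\<forall>t\<in>{2..2 * int n}. even t \<longrightarrow> (\<Sum>i\<le>n. \<Sum>j\<le>n. alpha d t i j * z i * z j) = 0)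
    \<longleftrightarrow> (\<forall>k\<le>n. k \<noteq> 0 \<longrightarrow> S k = 0)" (is "?L \<longleftrightarrow> ?R")
  proof
    assume L: ?L
    show ?R
    proof (intro allI impI)
      fix k assume "k \<le> n" "k \<noteq> 0"
      then have "int (2 * k) \<in> {2..2 * int n}" by simp
      then show "S k = 0" unfolding S_def using L[rule_format, of "int (2 * k)"] by simp
    qed
  next
    assume R: ?R
    show ?L
    proof (intro ballI impI)
      fix t :: int assume t: "t \<in> {2..2 * int n}" "even t"
      define k where "k = nat (t div 2)"
      have k: "t = int (2 * k)" "k \<le> n" "k \<noteq> 0" using t by (auto simp: k_def)
      then have "S k = 0" using R by blast
      then show "(\<Sum>i\<le>n. \<Sum>j\<le>n. alpha d t i j * z i * z j) = 0" by (simp only: S_def k(1))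
    qed
  qed
  moreover have "z \<in> involutors d \<longleftrightarrow> ?L \<and> S 0 = 1"
    using assms unfolding involutors_def n_def[symmetric] S0 by simp
  ultimately have "z \<in> involutors d \<longleftrightarrow> (\<forall>k\<le>n. k \<noteq> 0 \<longrightarrow> S k = 0) \<and> S 0 = 1"
    by (simp only:)
  also have "\<dots> \<longleftrightarrow> (\<forall>k\<le>n. S k = (if k = 0 then 1 else 0))"
    by auto
  also have "\<dots> \<longleftrightarrow> (\<forall>l\<le>d. (\<Sum>k\<le>n. S k * eigval d (2 * k) l) = 1)"
  proof
    assume S: "\<forall>k\<le>n. S k = (if k = 0 then 1 else 0)"
    show "\<forall>l\<le>d. (\<Sum>k\<le>n. S k * eigval d (2 * k) l) = 1"
    proof (intro allI impI)
      fix l assume "l \<le> d"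
      have "(\<Sum>k\<le>n. S k * eigval d (2 * k) l) = (\<Sum>k\<in>{0}. S k * eigval d (2 * k) l)"
        by (rule sum.mono_neutral_right) (use S in auto)
      then show "(\<Sum>k\<le>n. S k * eigval d (2 * k) l) = 1" using S \<open>l \<le> d\<close> by (simp add: eigval_0)
    qed
  next
    assume one: "\<forall>l\<le>d. (\<Sum>k\<le>n. S k * eigval d (2 * k) l) = 1"
    define \<beta> where "\<beta> k = S k - (if k = 0 then 1 else 0)" for k :: nat
    have zero: "(\<Sum>k\<le>n. \<beta> k * eigval d (2 * k) l) = 0" if "l \<le> d" for l
    proof -
      have "(\<Sum>k\<le>n. (if k = 0 then 1 else 0) * eigval d (2 * k) l) = (\<Sum>k\<in>{0}. eigval d (2 * k) l)"
        by (rule sum.mono_neutral_cong_right) auto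
      then show ?thesis using one that by (simp add: \<beta>_def left_diff_distrib sum_subtractf eigval_0)
    qed
    have "\<beta> k = 0" if k: "k \<le> n" for k
    proof -
      have "\<beta> k * (eigval_scale d (2 * k) * dcheb_norm d (int (2 * k)))
        = (\<Sum>l\<le>d. (\<Sum>i\<le>n. \<beta> i * eigval d (2 * i) l) * dcheb d (int (2 * k)) l)"
        by (rule eigval_coefficient[symmetric, of "\<lambda>k. 2 * k"]) (use k in \<open>auto simp: inj_on_def\<close>)
      also have "\<dots> = 0" by (simp add: zero)
      finally show ?thesis using eigval_scale_norm_nz[of "2 * k" d] k by (simp add: n_def)
    qed
    then show "\<forall>k\<le>n. S k = (if k = 0 then 1 else 0)" by (simp add: \<beta>_def)
  qed
  also have "\<dots> \<longleftrightarrow> (\<forall>l\<le>d. (\<Sum>i\<le>d div 2. z i * eigval d (d - 2 * i) l)^2 = 1)"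
    using eigval_square[of _ d z] by (simp add: S_def n_def)
  finally show ?thesis .
qed

text \<open>The expansion of $s$ in the orthogonal basis: by the symmetry of a sign sequence, only degrees of the parity of
$d$ contribute, and \<open>zseq_eq\<close> identifies their coefficients.\<close>

lemma zseq_eigenvalues:
  assumes s: "s \<in> sign_sequences d" and l: "l \<le> d"
  shows "(\<Sum>i\<le>d div 2. zseq d s i * eigval d (d - 2 * i) l) = of_int (s l)"
proof -
  define c where "c = (\<lambda>a. \<Sum>l\<le>d. of_int (s l) * dcheb d (int a) l)"
  have odd: "c a = 0" if "odd (d + a)" for a
  proof -
    have "c a = (\<Sum>l\<le>d. of_int (s (d - l)) * dcheb d (int a) (d - l))"
      unfolding c_def by (rule sum_reflect[symmetric])
    also have "\<dots> = (\<Sum>l\<le>d. - (of_int (s l) * dcheb d (int a) l))"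
    proof (rule sum.cong[OF refl])
      fix l assume "l \<in> {..d}"
      then have "s (d - l) = (-1) ^ d * s l" "l \<le> d" using s by (simp_all add: sign_sequences_def)
      then show "of_int (s (d - l)) * dcheb d (int a) (d - l) = - (of_int (s l) * dcheb d (int a) l)"
        using that by (auto simp: dcheb_reflect minus_one_power_iff)
    qed
    finally show ?thesis by (simp add: sum_negf c_def)
  qed
  have "of_int (s l) = (\<Sum>a\<le>d. c a / dcheb_norm d (int a) * dcheb d (int a) l)"
    unfolding c_def by (rule dcheb_expansion[OF l])
  also have "\<dots> = (\<Sum>a\<in>(\<lambda>i. d - 2 * i) ` {..d div 2}. c a / dcheb_norm d (int a) * dcheb d (int a) l)"
  proof (rule sum.mono_neutral_right)
    show "\<forall>a\<in>{..d} - (\<lambda>i. d - 2 * i) ` {..d div 2}. c a / dcheb_norm d (int a) * dcheb d (int a) l = 0"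
    proof
      fix a assume a: "a \<in> {..d} - (\<lambda>i. d - 2 * i) ` {..d div 2}"
      have "odd (d + a)"
      proof
        assume "even (d + a)"
        then have "even (d - a)" using a by simp
        then obtain i where "d - a = 2 * i" by (elim evenE)
        then have "a = d - 2 * i" "i \<le> d div 2" using a by auto
        then show False using a by blast
      qed
      then show "c a / dcheb_norm d (int a) * dcheb d (int a) l = 0" by (simp add: odd)
    qed
  qed auto
  also have "\<dots> = (\<Sum>i\<le>d div 2. c (d - 2 * i) / dcheb_norm d (int (d - 2 * i)) * dcheb d (int (d - 2 * i)) l)"
    by (subst sum.reindex) (auto simp: inj_on_def)
  also have "\<dots> = (\<Sum>i\<le>d div 2. zseq d s i * eigval d (d - 2 * i) l)"
  proof (rule sum.cong[OF refl])
    fix i assume "i \<in> {..d div 2}"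
    then have "zseq d s i * (eigval_scale d (d - 2 * i) * dcheb_norm d (int (d - 2 * i))) = c (d - 2 * i)"
      unfolding c_def by (intro zseq_eq[OF s]) simp
    moreover have "dcheb_norm d (int (d - 2 * i)) \<noteq> 0" by (rule dcheb_norm_nz) auto
    ultimately show "c (d - 2 * i) / dcheb_norm d (int (d - 2 * i)) * dcheb d (int (d - 2 * i)) l = zseq d s i * eigval d (d - 2 * i) l"
      by (auto simp: eigval_def field_simps)
  qed
  finally show ?thesis by simp
qed

theorem theorem3p2:
  fixes d :: nat
  assumes "d \<ge> 1"
  shows "(\<forall>s\<in>sign_sequences d. zseq d s \<in> involutors d) \<and>
         (\<forall>z\<in>involutors d. \<exists>!s. s \<in> sign_sequences d \<and> z = zseq d s)"
proof (intro conjI ballI)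
  fix s assume s: "s \<in> sign_sequences d"
  have ext: "zseq d s \<in> {..d div 2} \<rightarrow>\<^sub>E UNIV" by (simp add: zseq_def)
  have "(of_int (s l) :: complex)^2 = 1" if "l \<le> d" for l
  proof -
    have "s l = 1 \<or> s l = -1" using s that by (auto simp: sign_sequences_def PiE_iff)
    then show ?thesis by auto
  qed
  then show "zseq d s \<in> involutors d"
    unfolding involutors_iff[OF ext] by (simp add: zseq_eigenvalues[OF s])
next
  fix z assume z: "z \<in> involutors d"
  then have ext: "z \<in> {..d div 2} \<rightarrow>\<^sub>E UNIV" by (simp add: involutors_def)
  define \<mu> where "\<mu> l = (\<Sum>i\<le>d div 2. z i * eigval d (d - 2 * i) l)" for l
  have "\<mu> l ^ 2 = 1" if "l \<le> d" for l
    using z that unfolding involutors_iff[OF ext] \<mu>_def by blast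
  then have pm: "\<mu> l = 1 \<or> \<mu> l = -1" if "l \<le> d" for l
    using that by (simp add: power2_eq_1_iff)
  define s where "s = (\<lambda>l\<in>{..d}. if \<mu> l = 1 then 1 else -1 :: int)"
  have s_eq: "of_int (s l) = \<mu> l" if "l \<le> d" for l
    using pm[OF that] that by (auto simp: s_def)
  have \<mu>_reflect: "\<mu> (d - l) = (-1) ^ d * \<mu> l" if "l \<le> d" for l
  proof -
    have "eigval d (d - 2 * i) (d - l) = (-1) ^ d * eigval d (d - 2 * i) l" if "i \<le> d div 2" for i
    proof -
      have "2 * i \<le> d" using that by simp
      then show ?thesis using \<open>l \<le> d\<close> by (auto simp: eigval_def dcheb_reflect minus_one_power_iff)
    qed
    then show ?thesis by (simp add: \<mu>_def sum_distrib_left mult.left_commute)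
  qed
  have s: "s \<in> sign_sequences d"
  proof -
    have "s (d - l) = (-1) ^ d * s l" if "l \<le> d" for l
    proof -
      have "(of_int (s (d - l)) :: complex) = of_int ((-1) ^ d * s l)"
        using \<mu>_reflect[OF that] that by (simp add: s_eq)
      then show ?thesis by (simp only: of_int_eq_iff)
    qed
    then show ?thesis by (auto simp: sign_sequences_def s_def)
  qed
  have "z i = zseq d s i" if "i \<le> d div 2" for i
  proof -
    have "z i * (eigval_scale d (d - 2 * i) * dcheb_norm d (int (d - 2 * i))) = (\<Sum>l\<le>d. \<mu> l * dcheb d (int (d - 2 * i)) l)"
      unfolding \<mu>_def
      by (rule eigval_coefficient[symmetric, of "\<lambda>i. d - 2 * i"]) (use that in \<open>auto simp: inj_on_def\<close>)
    also have "\<dots> = zseq d s i * (eigval_scale d (d - 2 * i) * dcheb_norm d (int (d - 2 * i)))"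
      unfolding zseq_eq[OF s that] by (simp add: s_eq)
    finally show ?thesis using eigval_scale_norm_nz[of "d - 2 * i" d] by simp
  qed
  then have z_eq: "z = zseq d s"
    using ext by (intro extensionalityI[where A = "{..d div 2}"]) (auto simp: zseq_def PiE_iff)
  show "\<exists>!s. s \<in> sign_sequences d \<and> z = zseq d s"
  proof (rule ex1I[of _ s])
    fix s' assume s': "s' \<in> sign_sequences d \<and> z = zseq d s'"
    have "s' l = s l" if "l \<le> d" for l
    proof -
      have "(of_int (s' l) :: complex) = of_int (s l)"
        using zseq_eigenvalues[of s' d l] zseq_eigenvalues[of s d l] s s' z_eq that by simp
      then show ?thesis by simp
    qed
    then show "s' = s"
      using s s' by (intro extensionalityI[where A = "{..d}"]) (auto simp: sign_sequences_def PiE_iff)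
  qed (use s z_eq in auto)
qed

end
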